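(* Let $\alpha$ be a set with an involution $\tau\colon\alpha\to\alpha$, and let $\beta\subset\alpha$ be a subset such that $\tau(\beta)=\beta$. The triple $(\mathcal{K}_\beta(w),V_-,V_+)$, considered up to isomorphism, is a homotopy invariant of a nanoword $w$ over $\alpha$. That is, if nanowords $w,w'$ over $\alpha$ are homotopic, then there is an isomorphism of $\alpha$-keis $\mathcal{K}_\beta(w)\to\mathcal{K}_\beta(w')$ carrying the input $V_-$ of $\mathcal{K}_\beta(w)$ to the input of $\mathcal{K}_\beta(w')$ and the output $V_+$ of $\mathcal{K}_\beta(w)$ to the output of $\mathcal{K}_\beta(w')$.
   Context: Fix a set $\alpha$ with an involution $\tau\colon\alpha\to\alpha$. An $\alpha$-alphabet is a set $\mathcal{A}$ with a map $\mathcal{A}\to\alpha$, $A\mapsto|A|$. A nanoword over $\alpha$ is a pair $(\mathcal{A},w)$, where $\mathcal{A}$ is a finite $\alpha$-alphabet and $w$ is a word (finite sequence) in letters of $\mathcal{A}$ in which every letter of $\mathcal{A}$ appears exactly twice. Two nanowords are isomorphic if there is a bijection of their alphabets commuting with the maps to $\alpha$ that sends the first word letterwise to the second. Homotopy of nanowords is the equivalence relation generated by isomorphisms and the following three moves and their inverses: (i) $(\mathcal{A},xAAy)\mapsto(\mathcal{A}-\{A\},xy)$, where $x,y$ are words on $\mathcal{A}-\{A\}$; (ii) $(\mathcal{A},xAByBAz)\mapsto(\mathcal{A}-\{A,B\},xyz)$ if $|A|=\tau(|B|)$, where $x,y,z$ are words on $\mathcal{A}-\{A,B\}$; (iii) $(\mathcal{A},xAByACzBCt)\mapsto(\mathcal{A},xBAyCAzCBt)$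 if $|A|=|B|=|C|$, where $x,y,z,t$ are words on $\mathcal{A}-\{A,B,C\}$. Here $A$, $B$, $C$ are distinct letters of $\mathcal{A}$. An $\alpha$-kei is a non-empty set $X$ with maps $X\to X$, $x\mapsto ax$, and $X\times X\to X$, $(x,y)\mapsto x*_a y$, for each $a\in\alpha$, such that for all $a\in\alpha$ and $x,y,z\in X$: (1) $ax*_a x=x$; (2) $a(x*_a y)=ax*_a ay$; (3) $(x*_a y)*_a z=(x*_a az)*_a(y*_a z)$; (4) $a\tau(a)x=x$; (5) $(x*_a y)*_{\tau(a)}ay=x$. Here $ax*_a y$ means $(ax)*_a y$, and similarly $x*_a ay$ means $x*_a(ay)$. Homomorphisms and isomorphisms of $\alpha$-keis are maps (resp. bijections) commuting with all these operations; $\alpha$-keis can be presented by generators and relations in the usual sense. For a nanoword $(\mathcal{A},w)$ of length $n$, $\mathcal{K}_\beta(w)$ is the $\alpha$-kei generated by $n+1$ symbols $X_0,X_1,\dots,X_n$ subject to the following $n$ defining relations, two for each letter $A\in\mathcal{A}$. Let $a=|A|$ and let $i<j$ be the positions of the first and second occurrences of $A$ in $w$. If $a\in\beta$, the relations are $X_i=aX_{i-1}$ and $X_j=X_{j-1}*_a X_{i-1}$. If $a\in\alpha-\beta$, the relations are $X_i=X_{i-1}*_a X_{j-1}$ and $X_j=aX_{j-1}$. The input is $V_-=X_0\in\mathcal{K}_\beta(w)$ and the output is $V_+=X_n\in\mathcal{K}_\beta(w)$. *)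

theory Defs
  imports Main
begin

section \<open>Nanowords and their homotopy\<close>

definition involution_on :: "'a set \<Rightarrow> ('a \<Rightarrow> 'a) \<Rightarrow> bool" where
  "involution_on \<alpha> \<tau> \<longleftrightarrow> (\<forall>a\<in>\<alpha>. \<tau> a \<in> \<alpha> \<and> \<tau> (\<tau> a) = a)"

text \<open>Only the values of \<open>proj\<close> on the alphabet matter: nanowords that differ in the values of
  \<open>proj\<close> elsewhere are isomorphic via the identity.\<close>

record ('l, 'a) nanoword =
  alphabet :: "'l set"
  proj :: "'l \<Rightarrow> 'a"
  word :: "'l list"

definition is_nanoword :: "'a set \<Rightarrow> ('l, 'a) nanoword \<Rightarrow> bool" where
  "is_nanoword \<alpha> N \<longleftrightarrow>
     finite (alphabet N) \<and> proj N ` alphabet N \<subseteq> \<alpha> \<and>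
     word N \<in> lists (alphabet N) \<and>
     (\<forall>A\<in>alphabet N. count_list (word N) A = 2)"

definition nanoword_isomorphic :: "('l, 'a) nanoword \<Rightarrow> ('l, 'a) nanoword \<Rightarrow> bool" where
  "nanoword_isomorphic N N' \<longleftrightarrow>
     (\<exists>f. bij_betw f (alphabet N) (alphabet N') \<and>
          (\<forall>A\<in>alphabet N. proj N' (f A) = proj N A) \<and>
          map f (word N) = word N')"

inductive homotopy_move ::
  "'a set \<Rightarrow> ('a \<Rightarrow> 'a) \<Rightarrow> ('l, 'a) nanoword \<Rightarrow> ('l, 'a) nanoword \<Rightarrow> bool"
  for \<alpha> :: "'a set" and \<tau> :: "'a \<Rightarrow> 'a"
where
  move1: "\<lbrakk>is_nanoword \<alpha> \<lparr>alphabet = S, proj = p, word = x @ [A, A] @ y\<rparr>;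
     A \<in> S; x \<in> lists (S - {A}); y \<in> lists (S - {A})\<rbrakk> \<Longrightarrow>
   homotopy_move \<alpha> \<tau>
     \<lparr>alphabet = S, proj = p, word = x @ [A, A] @ y\<rparr>
     \<lparr>alphabet = S - {A}, proj = p, word = x @ y\<rparr>"
| move2: "\<lbrakk>is_nanoword \<alpha> \<lparr>alphabet = S, proj = p, word = x @ [A, B] @ y @ [B, A] @ z\<rparr>;
     A \<in> S; B \<in> S; A \<noteq> B; p A = \<tau> (p B);
     x \<in> lists (S - {A, B}); y \<in> lists (S - {A, B}); z \<in> lists (S - {A, B})\<rbrakk> \<Longrightarrow>
   homotopy_move \<alpha> \<tau>
     \<lparr>alphabet = S, proj = p, word = x @ [A, B] @ y @ [B, A] @ z\<rparr>
     \<lparr>alphabet = S - {A, B}, proj = p, word = x @ y @ z\<rparr>"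
| move3: "\<lbrakk>is_nanoword \<alpha>
       \<lparr>alphabet = S, proj = p, word = x @ [A, B] @ y @ [A, C] @ z @ [B, C] @ t\<rparr>;
     A \<in> S; B \<in> S; C \<in> S; A \<noteq> B; A \<noteq> C; B \<noteq> C; p A = p B; p B = p C;
     x \<in> lists (S - {A, B, C}); y \<in> lists (S - {A, B, C});
     z \<in> lists (S - {A, B, C}); t \<in> lists (S - {A, B, C})\<rbrakk> \<Longrightarrow>
   homotopy_move \<alpha> \<tau>
     \<lparr>alphabet = S, proj = p, word = x @ [A, B] @ y @ [A, C] @ z @ [B, C] @ t\<rparr>
     \<lparr>alphabet = S, proj = p, word = x @ [B, A] @ y @ [C, A] @ z @ [C, B] @ t\<rparr>"

text \<open>All letters are taken from one type \<open>'l\<close>, which plays the role of a universe of letters. An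
  inverse move needs fresh letters, so the definition has its intended meaning for infinite
  \<open>'l\<close>.\<close>

definition homotopic ::
  "'a set \<Rightarrow> ('a \<Rightarrow> 'a) \<Rightarrow> ('l, 'a) nanoword \<Rightarrow> ('l, 'a) nanoword \<Rightarrow> bool" where
  "homotopic \<alpha> \<tau> N N' \<longleftrightarrow>
     is_nanoword \<alpha> N \<and> is_nanoword \<alpha> N' \<and>
     equivclp (\<lambda>M M'. is_nanoword \<alpha> M \<and> is_nanoword \<alpha> M' \<and>
       (nanoword_isomorphic M M' \<or> homotopy_move \<alpha> \<tau> M M')) N N'"


section \<open>Keis\<close>

text \<open>\<open>app K a x\<close> is $ax$ and \<open>star K a x y\<close> is $x *_a y$.\<close>

record ('a, 'x) kei =
  carrier :: "'x set"
  app :: "'a \<Rightarrow> 'x \<Rightarrow> 'x"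
  star :: "'a \<Rightarrow> 'x \<Rightarrow> 'x \<Rightarrow> 'x"

locale alpha_kei =
  fixes \<alpha> :: "'a set" and \<tau> :: "'a \<Rightarrow> 'a" and K :: "('a, 'x) kei"
  assumes nonempty: "carrier K \<noteq> {}"
    and app_closed: "\<lbrakk>a \<in> \<alpha>; x \<in> carrier K\<rbrakk> \<Longrightarrow> app K a x \<in> carrier K"
    and star_closed: "\<lbrakk>a \<in> \<alpha>; x \<in> carrier K; y \<in> carrier K\<rbrakk> \<Longrightarrow> star K a x y \<in> carrier K"
    and kei1: "\<lbrakk>a \<in> \<alpha>; x \<in> carrier K\<rbrakk> \<Longrightarrow> star K a (app K a x) x = x"
    and kei2: "\<lbrakk>a \<in> \<alpha>; x \<in> carrier K; y \<in> carrier K\<rbrakk> \<Longrightarrow>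
      app K a (star K a x y) = star K a (app K a x) (app K a y)"
    and kei3: "\<lbrakk>a \<in> \<alpha>; x \<in> carrier K; y \<in> carrier K; z \<in> carrier K\<rbrakk> \<Longrightarrow>
      star K a (star K a x y) z = star K a (star K a x (app K a z)) (star K a y z)"
    and kei4: "\<lbrakk>a \<in> \<alpha>; x \<in> carrier K\<rbrakk> \<Longrightarrow> app K a (app K (\<tau> a) x) = x"
    and kei5: "\<lbrakk>a \<in> \<alpha>; x \<in> carrier K; y \<in> carrier K\<rbrakk> \<Longrightarrow>
      star K (\<tau> a) (star K a x y) (app K a y) = x"

definition kei_hom :: "'a set \<Rightarrow> ('a, 'x) kei \<Rightarrow> ('a, 'y) kei \<Rightarrow> ('x \<Rightarrow> 'y) set" where
  "kei_hom \<alpha> K L = {\<phi>.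
     \<phi> ` carrier K \<subseteq> carrier L \<and>
     (\<forall>a\<in>\<alpha>. \<forall>x\<in>carrier K. \<phi> (app K a x) = app L a (\<phi> x)) \<and>
     (\<forall>a\<in>\<alpha>. \<forall>x\<in>carrier K. \<forall>y\<in>carrier K. \<phi> (star K a x y) = star L a (\<phi> x) (\<phi> y))}"

definition kei_iso :: "'a set \<Rightarrow> ('a, 'x) kei \<Rightarrow> ('a, 'y) kei \<Rightarrow> ('x \<Rightarrow> 'y) set" where
  "kei_iso \<alpha> K L = {\<phi> \<in> kei_hom \<alpha> K L. bij_betw \<phi> (carrier K) (carrier L)}"


section \<open>Presentations by generators and relations\<close>

datatype ('a, 'g) kei_term =
  Gen 'g
| App 'a "('a, 'g) kei_term"
| Star 'a "('a, 'g) kei_term" "('a, 'g) kei_term"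

inductive_set kei_terms :: "'a set \<Rightarrow> 'g set \<Rightarrow> ('a, 'g) kei_term set"
  for \<alpha> :: "'a set" and G :: "'g set"
where
  Gen: "g \<in> G \<Longrightarrow> Gen g \<in> kei_terms \<alpha> G"
| App: "\<lbrakk>a \<in> \<alpha>; s \<in> kei_terms \<alpha> G\<rbrakk> \<Longrightarrow> App a s \<in> kei_terms \<alpha> G"
| Star: "\<lbrakk>a \<in> \<alpha>; s \<in> kei_terms \<alpha> G; t \<in> kei_terms \<alpha> G\<rbrakk> \<Longrightarrow> Star a s t \<in> kei_terms \<alpha> G"

text \<open>The smallest congruence on terms that contains the relations \<open>R\<close> and all instances of the
  kei axioms.\<close>

inductive kei_cong ::
  "'a set \<Rightarrow> ('a \<Rightarrow> 'a) \<Rightarrow> 'g set \<Rightarrow> (('a, 'g) kei_term \<times> ('a, 'g) kei_term) set \<Rightarrow>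
   ('a, 'g) kei_term \<Rightarrow> ('a, 'g) kei_term \<Rightarrow> bool"
  for \<alpha> :: "'a set" and \<tau> :: "'a \<Rightarrow> 'a" and G :: "'g set" and
    R :: "(('a, 'g) kei_term \<times> ('a, 'g) kei_term) set"
where
  rel: "\<lbrakk>(s, t) \<in> R; s \<in> kei_terms \<alpha> G; t \<in> kei_terms \<alpha> G\<rbrakk> \<Longrightarrow> kei_cong \<alpha> \<tau> G R s t"
| refl: "s \<in> kei_terms \<alpha> G \<Longrightarrow> kei_cong \<alpha> \<tau> G R s s"
| sym: "kei_cong \<alpha> \<tau> G R s t \<Longrightarrow> kei_cong \<alpha> \<tau> G R t s"
| trans: "\<lbrakk>kei_cong \<alpha> \<tau> G R s t; kei_cong \<alpha> \<tau> G R t u\<rbrakk> \<Longrightarrow> kei_cong \<alpha> \<tau> G R s u"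
| App: "\<lbrakk>a \<in> \<alpha>; kei_cong \<alpha> \<tau> G R s s'\<rbrakk> \<Longrightarrow> kei_cong \<alpha> \<tau> G R (App a s) (App a s')"
| Star: "\<lbrakk>a \<in> \<alpha>; kei_cong \<alpha> \<tau> G R s s'; kei_cong \<alpha> \<tau> G R t t'\<rbrakk> \<Longrightarrow>
    kei_cong \<alpha> \<tau> G R (Star a s t) (Star a s' t')"
| ax1: "\<lbrakk>a \<in> \<alpha>; s \<in> kei_terms \<alpha> G\<rbrakk> \<Longrightarrow> kei_cong \<alpha> \<tau> G R (Star a (App a s) s) s"
| ax2: "\<lbrakk>a \<in> \<alpha>; s \<in> kei_terms \<alpha> G; t \<in> kei_terms \<alpha> G\<rbrakk> \<Longrightarrow>
    kei_cong \<alpha> \<tau> G R (App a (Star a s t)) (Star a (App a s) (App a t))"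
| ax3: "\<lbrakk>a \<in> \<alpha>; s \<in> kei_terms \<alpha> G; t \<in> kei_terms \<alpha> G; u \<in> kei_terms \<alpha> G\<rbrakk> \<Longrightarrow>
    kei_cong \<alpha> \<tau> G R (Star a (Star a s t) u) (Star a (Star a s (App a u)) (Star a t u))"
| ax4: "\<lbrakk>a \<in> \<alpha>; s \<in> kei_terms \<alpha> G\<rbrakk> \<Longrightarrow> kei_cong \<alpha> \<tau> G R (App a (App (\<tau> a) s)) s"
| ax5: "\<lbrakk>a \<in> \<alpha>; s \<in> kei_terms \<alpha> G; t \<in> kei_terms \<alpha> G\<rbrakk> \<Longrightarrow>
    kei_cong \<alpha> \<tau> G R (Star (\<tau> a) (Star a s t) (App a t)) s"

definition kei_class ::
  "'a set \<Rightarrow> ('a \<Rightarrow> 'a) \<Rightarrow> 'g set \<Rightarrow> (('a, 'g) kei_term \<times> ('a, 'g) kei_term) set \<Rightarrow>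
   ('a, 'g) kei_term \<Rightarrow> ('a, 'g) kei_term set" where
  "kei_class \<alpha> \<tau> G R t = {u. kei_cong \<alpha> \<tau> G R t u}"

definition presented_kei ::
  "'a set \<Rightarrow> ('a \<Rightarrow> 'a) \<Rightarrow> 'g set \<Rightarrow> (('a, 'g) kei_term \<times> ('a, 'g) kei_term) set \<Rightarrow>
   ('a, ('a, 'g) kei_term set) kei" where
  "presented_kei \<alpha> \<tau> G R =
     \<lparr>carrier = kei_class \<alpha> \<tau> G R ` kei_terms \<alpha> G,
      app = (\<lambda>a X. \<Union>s\<in>X. kei_class \<alpha> \<tau> G R (App a s)),
      star = (\<lambda>a X Y. \<Union>s\<in>X. \<Union>t\<in>Y. kei_class \<alpha> \<tau> G R (Star a s t))\<rparr>"

lemma kei_cong_terms: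
  assumes "involution_on \<alpha> \<tau>" "kei_cong \<alpha> \<tau> G R s t"
  shows "s \<in> kei_terms \<alpha> G \<and> t \<in> kei_terms \<alpha> G"
  using assms(2)
  by induction (use assms(1) in \<open>auto simp: involution_on_def intro!: kei_terms.intros\<close>)

lemma kei_class_eq_iff:
  assumes "s \<in> kei_terms \<alpha> G"
  shows "kei_class \<alpha> \<tau> G R s = kei_class \<alpha> \<tau> G R t \<longleftrightarrow> kei_cong \<alpha> \<tau> G R s t"
proof
  assume "kei_class \<alpha> \<tau> G R s = kei_class \<alpha> \<tau> G R t"
  moreover have "s \<in> kei_class \<alpha> \<tau> G R s"
    using assms by (simp add: kei_class_def kei_cong.refl)
  ultimately show "kei_cong \<alpha> \<tau> G R s t"
    by (simp add: kei_class_def kei_cong.sym)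
next
  assume "kei_cong \<alpha> \<tau> G R s t"
  then show "kei_class \<alpha> \<tau> G R s = kei_class \<alpha> \<tau> G R t"
    unfolding kei_class_def by (blast intro: kei_cong.sym kei_cong.trans)
qed

lemma kei_class_eqI: "kei_cong \<alpha> \<tau> G R s t \<Longrightarrow> kei_class \<alpha> \<tau> G R s = kei_class \<alpha> \<tau> G R t"
  unfolding kei_class_def by (blast intro: kei_cong.sym kei_cong.trans)

lemma presented_kei_app:
  assumes "a \<in> \<alpha>" "s \<in> kei_terms \<alpha> G"
  shows "app (presented_kei \<alpha> \<tau> G R) a (kei_class \<alpha> \<tau> G R s) = kei_class \<alpha> \<tau> G R (App a s)"
  using assms unfolding presented_kei_def kei_class_def
  by (auto intro: kei_cong.App kei_cong.trans kei_cong.refl)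

lemma presented_kei_star:
  assumes "a \<in> \<alpha>" "s \<in> kei_terms \<alpha> G" "t \<in> kei_terms \<alpha> G"
  shows "star (presented_kei \<alpha> \<tau> G R) a (kei_class \<alpha> \<tau> G R s) (kei_class \<alpha> \<tau> G R t) =
    kei_class \<alpha> \<tau> G R (Star a s t)"
  using assms unfolding presented_kei_def kei_class_def
  by (auto intro: kei_cong.Star kei_cong.trans kei_cong.refl)

lemma carrier_presented_kei:
  "carrier (presented_kei \<alpha> \<tau> G R) = kei_class \<alpha> \<tau> G R ` kei_terms \<alpha> G"
  by (simp add: presented_kei_def)

lemma alpha_kei_presented_kei:
  assumes inv: "involution_on \<alpha> \<tau>" and ne: "G \<noteq> {}"
  shows "alpha_kei \<alpha> \<tau> (presented_kei \<alpha> \<tau> G R)"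
proof -
  have tau: "\<tau> a \<in> \<alpha>" if "a \<in> \<alpha>" for a
    using inv that by (simp add: involution_on_def)
  note simps = carrier_presented_kei presented_kei_app presented_kei_star kei_terms.App
    kei_terms.Star tau
  show ?thesis
  proof (unfold_locales, goal_cases)
    case 1
    from ne obtain g where "g \<in> G" by blast
    then show ?case using kei_terms.Gen[of g G \<alpha>] by (auto simp: simps)
  qed (auto simp: simps intro!: kei_class_eqI intro: kei_cong.intros del: equalityI subsetI)
qed

text \<open>The universal property of a presentation.\<close>

primrec kei_eval :: "('a, 'x) kei \<Rightarrow> ('g \<Rightarrow> 'x) \<Rightarrow> ('a, 'g) kei_term \<Rightarrow> 'x" where
  "kei_eval K f (Gen g) = f g"
| "kei_eval K f (App a s) = app K a (kei_eval K f s)"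
| "kei_eval K f (Star a s t) = star K a (kei_eval K f s) (kei_eval K f t)"

lemma presented_kei_universal:
  assumes inv: "involution_on \<alpha> \<tau>" and K: "alpha_kei \<alpha> \<tau> K"
    and f: "f ` G \<subseteq> carrier K"
    and R: "\<And>s t. \<lbrakk>(s, t) \<in> R; s \<in> kei_terms \<alpha> G; t \<in> kei_terms \<alpha> G\<rbrakk> \<Longrightarrow>
      kei_eval K f s = kei_eval K f t"
  shows "\<exists>\<phi>\<in>kei_hom \<alpha> (presented_kei \<alpha> \<tau> G R) K.
    \<forall>t\<in>kei_terms \<alpha> G. \<phi> (kei_class \<alpha> \<tau> G R t) = kei_eval K f t"
proof -
  interpret alpha_kei \<alpha> \<tau> K by (fact K)
  have ev: "kei_eval K f t \<in> carrier K" if "t \<in> kei_terms \<alpha> G" for t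
    using that by induction (use f in \<open>auto intro: app_closed star_closed\<close>)
  have cong: "kei_eval K f s = kei_eval K f t" if "kei_cong \<alpha> \<tau> G R s t" for s t
    using that
    by induction (auto simp: R ev app_closed star_closed kei1 kei2 kei4 kei5 intro: kei3)
  define \<phi> where "\<phi> X = kei_eval K f (SOME t. t \<in> X)" for X
  have \<phi>: "\<phi> (kei_class \<alpha> \<tau> G R t) = kei_eval K f t" if "t \<in> kei_terms \<alpha> G" for t
  proof -
    have "t \<in> kei_class \<alpha> \<tau> G R t"
      using that by (simp add: kei_class_def kei_cong.refl)
    then have "(SOME u. u \<in> kei_class \<alpha> \<tau> G R t) \<in> kei_class \<alpha> \<tau> G R t"
      by (rule someI)
    then show ?thesis
      unfolding \<phi>_def kei_class_def by (auto dest: cong)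
  qed
  have "\<phi> \<in> kei_hom \<alpha> (presented_kei \<alpha> \<tau> G R) K"
    by (auto simp: kei_hom_def carrier_presented_kei presented_kei_app presented_kei_star \<phi> ev
      kei_terms.App kei_terms.Star)
  with \<phi> show ?thesis by blast
qed


section \<open>The kei of a nanoword\<close>

text \<open>Positions in a word of length $n$ are numbered from $1$ to $n$.\<close>

definition letter_at :: "('l, 'a) nanoword \<Rightarrow> nat \<Rightarrow> 'l" where
  "letter_at N i = word N ! (i - 1)"

definition letter_pair :: "('l, 'a) nanoword \<Rightarrow> 'l \<Rightarrow> nat \<Rightarrow> nat \<Rightarrow> bool" where
  "letter_pair N A i j \<longleftrightarrow>
     1 \<le> i \<and> i < j \<and> j \<le> length (word N) \<and> letter_at N i = A \<and> letter_at N j = A"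

inductive_set nanoword_rels ::
  "'a set \<Rightarrow> ('l, 'a) nanoword \<Rightarrow> (('a, nat) kei_term \<times> ('a, nat) kei_term) set"
  for \<beta> :: "'a set" and N :: "('l, 'a) nanoword"
where
  in_first: "\<lbrakk>A \<in> alphabet N; a = proj N A; letter_pair N A i j; a \<in> \<beta>\<rbrakk> \<Longrightarrow>
    (Gen i, App a (Gen (i - 1))) \<in> nanoword_rels \<beta> N"
| in_second: "\<lbrakk>A \<in> alphabet N; a = proj N A; letter_pair N A i j; a \<in> \<beta>\<rbrakk> \<Longrightarrow>
    (Gen j, Star a (Gen (j - 1)) (Gen (i - 1))) \<in> nanoword_rels \<beta> N"
| notin_first: "\<lbrakk>A \<in> alphabet N; a = proj N A; letter_pair N A i j; a \<notin> \<beta>\<rbrakk> \<Longrightarrow>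
    (Gen i, Star a (Gen (i - 1)) (Gen (j - 1))) \<in> nanoword_rels \<beta> N"
| notin_second: "\<lbrakk>A \<in> alphabet N; a = proj N A; letter_pair N A i j; a \<notin> \<beta>\<rbrakk> \<Longrightarrow>
    (Gen j, App a (Gen (j - 1))) \<in> nanoword_rels \<beta> N"

text \<open>The generator $X_i$ is \<open>Gen i\<close>.\<close>

definition nanoword_kei ::
  "'a set \<Rightarrow> ('a \<Rightarrow> 'a) \<Rightarrow> 'a set \<Rightarrow> ('l, 'a) nanoword \<Rightarrow> ('a, ('a, nat) kei_term set) kei" where
  "nanoword_kei \<alpha> \<tau> \<beta> N =
     presented_kei \<alpha> \<tau> {0..length (word N)} (nanoword_rels \<beta> N)"

lemma alpha_kei_nanoword_kei:
  "involution_on \<alpha> \<tau> \<Longrightarrow> alpha_kei \<alpha> \<tau> (nanoword_kei \<alpha> \<tau> \<beta> N)"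
  unfolding nanoword_kei_def by (rule alpha_kei_presented_kei) auto

definition kei_input ::
  "'a set \<Rightarrow> ('a \<Rightarrow> 'a) \<Rightarrow> 'a set \<Rightarrow> ('l, 'a) nanoword \<Rightarrow> ('a, nat) kei_term set" where
  "kei_input \<alpha> \<tau> \<beta> N =
     kei_class \<alpha> \<tau> {0..length (word N)} (nanoword_rels \<beta> N) (Gen 0)"

definition kei_output ::
  "'a set \<Rightarrow> ('a \<Rightarrow> 'a) \<Rightarrow> 'a set \<Rightarrow> ('l, 'a) nanoword \<Rightarrow> ('a, nat) kei_term set" where
  "kei_output \<alpha> \<tau> \<beta> N =
     kei_class \<alpha> \<tau> {0..length (word N)} (nanoword_rels \<beta> N) (Gen (length (word N)))"

end

theory Submission
  imports Defs
begin

text \<open>A homomorphism from the kei of a nanoword to a kei \<open>K\<close> is the same as a colouring: an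
  assignment of elements of \<open>K\<close> to the edges \<open>0, \<dots>, n\<close> of the word (the gaps between its letters)
  that satisfies the defining relations. So it suffices to compare colourings. A homotopy move
  changes a word only in a few blocks of neighbouring letters, and for each move the kei axioms
  say that, whatever the colours outside these blocks are, the relations inside

  \<^item> can be solved before the move if and only if they can be solved after it (for a deleted block
  this means: if and only if the colours at its two ends agree), and

  \<^item> determine the colours of the edges inside the blocks from those outside.

  Hence colourings before and after the move correspond to each other bijectively, with equal
  colours on the surviving edges, in particular on the first and the last one. This is the content
  of the lemmas \<open>crossing_kink\<close>, \<open>crossing_bigon\<close> and \<open>crossing_triangle\<close> (the names refer to the
  shapes of the Reidemeister moves that the three moves imitate). Applied to the tautological
  colourings of the two words by the generators of their own keis, the correspondence yields
  mutually inverse homomorphisms (\<open>isomorphic_triples_if_correspondence\<close>), in the manner of the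
  Yoneda lemma. An isomorphism of nanowords does not change the colourings at all, and isomorphism
  of triples is an equivalence relation, so the result extends from single moves to homotopies.\<close>

section \<open>Homomorphisms out of a presented kei\<close>

lemma kei_hom_comp:
  assumes "\<phi> \<in> kei_hom \<alpha> K L" "\<psi> \<in> kei_hom \<alpha> L M"
  shows "\<psi> \<circ> \<phi> \<in> kei_hom \<alpha> K M"
  using assms unfolding kei_hom_def by (auto simp: image_subset_iff)

lemma kei_hom_id: "id \<in> kei_hom \<alpha> K K"
  by (simp add: kei_hom_def)

lemma presented_kei_hom_ext:
  assumes \<phi>: "\<phi> \<in> kei_hom \<alpha> (presented_kei \<alpha> \<tau> G R) L"
    and \<psi>: "\<psi> \<in> kei_hom \<alpha> (presented_kei \<alpha> \<tau> G R) L"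
    and eq: "\<And>g. g \<in> G \<Longrightarrow>
      \<phi> (kei_class \<alpha> \<tau> G R (Gen g)) = \<psi> (kei_class \<alpha> \<tau> G R (Gen g))"
    and X: "X \<in> carrier (presented_kei \<alpha> \<tau> G R)"
  shows "\<phi> X = \<psi> X"
proof -
  let ?K = "presented_kei \<alpha> \<tau> G R" and ?c = "kei_class \<alpha> \<tau> G R"
  have c: "?c t \<in> carrier ?K" if "t \<in> kei_terms \<alpha> G" for t
    using that by (simp add: carrier_presented_kei)
  have "\<phi> (?c t) = \<psi> (?c t)" if "t \<in> kei_terms \<alpha> G" for t
    using that
  proof induction
    case (Gen g)
    then show ?case by (rule eq)
  next
    case (App a s)
    with c[of s] \<phi> \<psi> show ?case
      by (simp add: kei_hom_def flip: presented_kei_app)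
  next
    case (Star a s t)
    with c[of s] c[of t] \<phi> \<psi> show ?case
      by (simp add: kei_hom_def flip: presented_kei_star)
  qed
  with X show ?thesis by (auto simp: carrier_presented_kei)
qed


section \<open>Colourings\<close>

text \<open>The position \<open>i\<close> (counted from \<open>0\<close>) is a step from edge \<open>i\<close> to edge \<open>i + 1\<close>. Recording the
  letter of a step together with the colours of its two edges turns cutting a word into pieces
  into cutting a list.\<close>

definition steps :: "'l list \<Rightarrow> (nat \<Rightarrow> 'x) \<Rightarrow> ('l \<times> 'x \<times> 'x) list" where
  "steps w f = map (\<lambda>i. (w ! i, f i, f (Suc i))) [0..<length w]"

lemma steps_Nil [simp]: "steps [] f = []"
  by (simp add: steps_def)

lemma length_steps [simp]: "length (steps w f) = length w"
  by (simp add: steps_def)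

lemma steps_Cons [simp]: "steps (A # w) f = (A, f 0, f 1) # steps w (\<lambda>i. f (Suc i))"
  by (simp add: steps_def map_upt_Suc del: upt_Suc)

lemma steps_append [simp]: "steps (v @ w) f = steps v f @ steps w (\<lambda>i. f (length v + i))"
  by (induction v arbitrary: f) auto

lemma steps_cong:
  assumes "\<And>i. i \<le> length w \<Longrightarrow> f i = g i"
  shows "steps w f = steps w g"
  using assms by (simp add: steps_def)

lemma map_fst_steps: "map fst (steps w f) = w"
  by (simp add: steps_def comp_def map_nth)

lemma fst_steps: "e \<in> set (steps w f) \<Longrightarrow> fst e \<in> set w"
  by (metis map_fst_steps image_eqI set_map)

text \<open>The condition that the two occurrences of a letter of value \<open>a\<close> impose on the colours \<open>u, v\<close>
  of the edges around the first one and \<open>u', v'\<close> around the second one.\<close>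

definition crossing :: "'a set \<Rightarrow> ('a, 'x) kei \<Rightarrow> 'a \<Rightarrow> 'x \<times> 'x \<Rightarrow> 'x \<times> 'x \<Rightarrow> bool" where
  "crossing \<beta> K a e e' \<longleftrightarrow>
     (case (e, e') of ((u, v), (u', v')) \<Rightarrow>
       if a \<in> \<beta> then v = app K a u \<and> v' = star K a u' u
       else v = star K a u u' \<and> v' = app K a u')"

lemma crossing_in [simp]:
  "a \<in> \<beta> \<Longrightarrow> crossing \<beta> K a (u, v) (u', v') \<longleftrightarrow> v = app K a u \<and> v' = star K a u' u"
  by (simp add: crossing_def)

lemma crossing_notin [simp]:
  "a \<notin> \<beta> \<Longrightarrow> crossing \<beta> K a (u, v) (u', v') \<longleftrightarrow> v = star K a u u' \<and> v' = app K a u'"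
  by (simp add: crossing_def)

definition compatible ::
  "'a set \<Rightarrow> ('a, 'x) kei \<Rightarrow> ('l \<Rightarrow> 'a) \<Rightarrow> 'l \<times> 'x \<times> 'x \<Rightarrow> 'l \<times> 'x \<times> 'x \<Rightarrow> bool" where
  "compatible \<beta> K p s s' \<longleftrightarrow> (fst s = fst s' \<longrightarrow> crossing \<beta> K (p (fst s)) (snd s) (snd s'))"

text \<open>Only steps with the same letter constrain each other; hence the conditions on disjoint sets
  of letters may be examined separately.\<close>

lemma sorted_wrt_compatible_split:
  "sorted_wrt (compatible \<beta> K p) es \<longleftrightarrow>
     sorted_wrt (compatible \<beta> K p) (filter (\<lambda>s. fst s \<in> T) es) \<and>
     sorted_wrt (compatible \<beta> K p) (filter (\<lambda>s. fst s \<notin> T) es)"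
proof (induction es)
  case (Cons s es)
  then show ?case by (cases "fst s \<in> T") (auto simp: compatible_def)
qed simp

text \<open>\<open>sorted_wrt\<close> compares every step with all later ones; in a nanoword exactly one pair of
  steps has a given letter, which yields the two relations of that letter. In this form the
  conditions split along concatenations and filters of words.\<close>

definition colouring ::
  "'a set \<Rightarrow> ('a, 'x) kei \<Rightarrow> ('l, 'a) nanoword \<Rightarrow> (nat \<Rightarrow> 'x) \<Rightarrow> bool" where
  "colouring \<beta> K N f \<longleftrightarrow>
     (\<forall>i\<le>length (word N). f i \<in> carrier K) \<and>
     sorted_wrt (compatible \<beta> K (proj N)) (steps (word N) f)"

lemma colouring_iff:
  "colouring \<beta> K N f \<longleftrightarrow>
     (\<forall>i\<le>length (word N). f i \<in> carrier K) \<and>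
     (\<forall>i j. i < j \<longrightarrow> j < length (word N) \<longrightarrow> word N ! i = word N ! j \<longrightarrow>
        crossing \<beta> K (proj N (word N ! i)) (f i, f (Suc i)) (f j, f (Suc j)))"
  by (simp add: colouring_def sorted_wrt_iff_nth_less compatible_def steps_def)

lemma colouring_hom:
  assumes N: "is_nanoword \<alpha> N" and \<phi>: "\<phi> \<in> kei_hom \<alpha> K L" and f: "colouring \<beta> K N f"
  shows "colouring \<beta> L N (\<lambda>i. \<phi> (f i))"
proof -
  have p: "proj N (word N ! i) \<in> \<alpha>" if "i < length (word N)" for i
    using N that unfolding is_nanoword_def by (metis image_subset_iff in_listsD nth_mem)
  have "crossing \<beta> L (proj N (word N ! i)) (\<phi> (f i), \<phi> (f (Suc i))) (\<phi> (f j), \<phi> (f (Suc j)))"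
    if ij: "i < j" "j < length (word N)" "word N ! i = word N ! j" for i j
  proof -
    have "crossing \<beta> K (proj N (word N ! i)) (f i, f (Suc i)) (f j, f (Suc j))"
      "f i \<in> carrier K" "f j \<in> carrier K" "proj N (word N ! i) \<in> \<alpha>"
      using f ij p[of i] by (auto simp: colouring_iff)
    then show ?thesis
      using \<phi> by (cases "proj N (word N ! i) \<in> \<beta>") (auto simp: kei_hom_def)
  qed
  moreover have "\<phi> (f i) \<in> carrier L" if "i \<le> length (word N)" for i
    using f \<phi> that by (auto simp: colouring_iff kei_hom_def)
  ultimately show ?thesis by (simp add: colouring_iff)
qed


section \<open>The kei of a nanoword represents its colourings\<close>

definition edge_class ::
  "'a set \<Rightarrow> ('a \<Rightarrow> 'a) \<Rightarrow> 'a set \<Rightarrow> ('l, 'a) nanoword \<Rightarrow> nat \<Rightarrow> ('a, nat) kei_term set" where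
  "edge_class \<alpha> \<tau> \<beta> N i = kei_class \<alpha> \<tau> {0..length (word N)} (nanoword_rels \<beta> N) (Gen i)"

lemma colouring_edge_class:
  assumes N: "is_nanoword \<alpha> N"
  shows "colouring \<beta> (nanoword_kei \<alpha> \<tau> \<beta> N) N (edge_class \<alpha> \<tau> \<beta> N)"
proof -
  let ?n = "length (word N)" and ?K = "nanoword_kei \<alpha> \<tau> \<beta> N" and ?R = "nanoword_rels \<beta> N"
  let ?c = "kei_class \<alpha> \<tau> {0..?n} ?R"
  have gen: "Gen i \<in> kei_terms \<alpha> {0..?n}" if "i \<le> ?n" for i
    using that by (auto intro: kei_terms.Gen)
  have rel: "?c s = ?c t"
    if "(s, t) \<in> ?R" "s \<in> kei_terms \<alpha> {0..?n}" "t \<in> kei_terms \<alpha> {0..?n}" for s t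
    using that by (intro kei_class_eqI kei_cong.rel)
  have "crossing \<beta> ?K (proj N (word N ! i))
      (edge_class \<alpha> \<tau> \<beta> N i, edge_class \<alpha> \<tau> \<beta> N (Suc i))
      (edge_class \<alpha> \<tau> \<beta> N j, edge_class \<alpha> \<tau> \<beta> N (Suc j))"
    if ij: "i < j" "j < ?n" "word N ! i = word N ! j" for i j
  proof -
    define A where "A = word N ! i"
    define a where "a = proj N A"
    have A: "A \<in> alphabet N"
      using N ij unfolding is_nanoword_def A_def by (metis in_listsD nth_mem)
    have a: "a \<in> \<alpha>" using A N by (auto simp: is_nanoword_def a_def)
    have pair: "letter_pair N A (Suc i) (Suc j)"
      using ij by (simp add: letter_pair_def letter_at_def A_def)
    note t = gen[of i] gen[of j] gen[of "Suc i"] gen[of "Suc j"]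
      kei_terms.App[OF a] kei_terms.Star[OF a]
    have "crossing \<beta> ?K a
      (edge_class \<alpha> \<tau> \<beta> N i, edge_class \<alpha> \<tau> \<beta> N (Suc i))
      (edge_class \<alpha> \<tau> \<beta> N j, edge_class \<alpha> \<tau> \<beta> N (Suc j))"
    proof (cases "a \<in> \<beta>")
      case True
      then have "?c (Gen (Suc i)) = ?c (App a (Gen i))"
        "?c (Gen (Suc j)) = ?c (Star a (Gen j) (Gen i))"
        using nanoword_rels.in_first[OF A a_def pair] nanoword_rels.in_second[OF A a_def pair] t ij
        by (auto intro!: rel del: equalityI subsetI)
      with True a t ij show ?thesis
        by (simp add: edge_class_def nanoword_kei_def presented_kei_app presented_kei_star)
    next
      case False
      then have "?c (Gen (Suc i)) = ?c (Star a (Gen i) (Gen j))"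
        "?c (Gen (Suc j)) = ?c (App a (Gen j))"
        using nanoword_rels.notin_first[OF A a_def pair] nanoword_rels.notin_second[OF A a_def pair]
          t ij
        by (auto intro!: rel del: equalityI subsetI)
      with False a t ij show ?thesis
        by (simp add: edge_class_def nanoword_kei_def presented_kei_app presented_kei_star)
    qed
    then show ?thesis by (simp only: a_def A_def)
  qed
  moreover have "edge_class \<alpha> \<tau> \<beta> N i \<in> carrier ?K" if "i \<le> ?n" for i
    using gen[OF that] by (simp add: edge_class_def nanoword_kei_def carrier_presented_kei)
  ultimately show ?thesis by (simp add: colouring_iff)
qed

lemma kei_hom_of_colouring:
  assumes inv: "involution_on \<alpha> \<tau>" and K: "alpha_kei \<alpha> \<tau> K" and f: "colouring \<beta> K N f"
  obtains \<phi> where "\<phi> \<in> kei_hom \<alpha> (nanoword_kei \<alpha> \<tau> \<beta> N) K"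
    "\<forall>i\<le>length (word N). \<phi> (edge_class \<alpha> \<tau> \<beta> N i) = f i"
proof -
  have cr: "crossing \<beta> K (proj N A) (f (i - 1), f i) (f (j - 1), f j)"
    if "letter_pair N A i j" for A i j
  proof -
    from that have "i - 1 < j - 1" "j - 1 < length (word N)" "word N ! (i - 1) = A"
      "word N ! (j - 1) = A" "Suc (i - 1) = i" "Suc (j - 1) = j"
      by (auto simp: letter_pair_def letter_at_def)
    with f show ?thesis unfolding colouring_iff by metis
  qed
  have "kei_eval K f s = kei_eval K f t" if "(s, t) \<in> nanoword_rels \<beta> N" for s t
    using that by cases (use cr in force)+
  moreover have "f ` {0..length (word N)} \<subseteq> carrier K"
    using f by (auto simp: colouring_def)
  ultimately obtain \<phi> where \<phi>: "\<phi> \<in> kei_hom \<alpha> (nanoword_kei \<alpha> \<tau> \<beta> N) K"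
    "\<forall>t\<in>kei_terms \<alpha> {0..length (word N)}.
      \<phi> (kei_class \<alpha> \<tau> {0..length (word N)} (nanoword_rels \<beta> N) t) = kei_eval K f t"
    using presented_kei_universal[OF inv K, of f "{0..length (word N)}" "nanoword_rels \<beta> N"]
    unfolding nanoword_kei_def by blast
  have "\<phi> (edge_class \<alpha> \<tau> \<beta> N i) = f i" if "i \<le> length (word N)" for i
    using \<phi>(2) that by (simp add: edge_class_def kei_terms.Gen)
  with \<phi>(1) show thesis by (blast intro: that)
qed

definition isomorphic_triples ::
  "'a set \<Rightarrow> ('a \<Rightarrow> 'a) \<Rightarrow> 'a set \<Rightarrow> ('l, 'a) nanoword \<Rightarrow> ('l, 'a) nanoword \<Rightarrow> bool" where
  "isomorphic_triples \<alpha> \<tau> \<beta> N N' \<longleftrightarrow>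
     (\<exists>\<phi> \<in> kei_iso \<alpha> (nanoword_kei \<alpha> \<tau> \<beta> N) (nanoword_kei \<alpha> \<tau> \<beta> N').
        \<phi> (kei_input \<alpha> \<tau> \<beta> N) = kei_input \<alpha> \<tau> \<beta> N' \<and>
        \<phi> (kei_output \<alpha> \<tau> \<beta> N) = kei_output \<alpha> \<tau> \<beta> N')"

text \<open>Half of a bijection between the colourings of \<open>N\<close> and of \<open>N'\<close> by \<open>K\<close> under which edges
  paired by \<open>P\<close> have equal colours. Pairing edges by a relation rather than by a function is
  essential: where a move deletes a block of letters, the edges at both ends of the block are
  paired with one edge of the shorter word.\<close>

definition colourings_carry_over ::
  "'a set \<Rightarrow> ('a, 'x) kei \<Rightarrow> (nat \<Rightarrow> nat \<Rightarrow> bool) \<Rightarrow>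
   ('l, 'a) nanoword \<Rightarrow> ('l, 'a) nanoword \<Rightarrow> bool" where
  "colourings_carry_over \<beta> K P N N' \<longleftrightarrow>
     (\<forall>f. colouring \<beta> K N f \<longrightarrow>
        (\<exists>f'. colouring \<beta> K N' f' \<and> (\<forall>i i'. P i i' \<longrightarrow> f' i' = f i))) \<and>
     (\<forall>f g. colouring \<beta> K N f \<longrightarrow> colouring \<beta> K N g \<longrightarrow> (\<forall>i i'. P i i' \<longrightarrow> f i = g i) \<longrightarrow>
        (\<forall>i\<le>length (word N). f i = g i))"

lemma carried_colouring:
  assumes "colourings_carry_over \<beta> K P N N'" "colouring \<beta> K N f"
  obtains f' where "colouring \<beta> K N' f'" "\<forall>i i'. P i i' \<longrightarrow> f' i' = f i"
  using assms unfolding colourings_carry_over_def by blast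

lemma colouring_determined:
  assumes "colourings_carry_over \<beta> K P N N'" "colouring \<beta> K N f" "colouring \<beta> K N g"
    "\<And>i i'. P i i' \<Longrightarrow> f i = g i" "i \<le> length (word N)"
  shows "f i = g i"
  using assms unfolding colourings_carry_over_def by blast

text \<open>Carrying the tautological colouring of each nanoword by the generators of its kei over to
  the other nanoword gives homomorphisms in both directions. Their composites fix the generators
  of paired edges, and a colouring is determined by its values there, so the composites are
  identities.\<close>

lemma isomorphic_triples_if_correspondence:
  fixes N N' :: "('l, 'a) nanoword"
  assumes inv: "involution_on \<alpha> \<tau>" and N: "is_nanoword \<alpha> N" and N': "is_nanoword \<alpha> N'"
    and P0: "P 0 0" and Pn: "P (length (word N)) (length (word N'))"
    and Ple: "\<And>i i'. P i i' \<Longrightarrow> i \<le> length (word N) \<and> i' \<le> length (word N')"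
    and carry: "\<And>K :: ('a, ('a, nat) kei_term set) kei. alpha_kei \<alpha> \<tau> K \<Longrightarrow>
      colourings_carry_over \<beta> K P N N'"
    and carry': "\<And>K :: ('a, ('a, nat) kei_term set) kei. alpha_kei \<alpha> \<tau> K \<Longrightarrow>
      colourings_carry_over \<beta> K (\<lambda>i' i. P i i') N' N"
  shows "isomorphic_triples \<alpha> \<tau> \<beta> N N'"
proof -
  let ?K = "nanoword_kei \<alpha> \<tau> \<beta> N" and ?K' = "nanoword_kei \<alpha> \<tau> \<beta> N'"
  let ?X = "edge_class \<alpha> \<tau> \<beta> N" and ?X' = "edge_class \<alpha> \<tau> \<beta> N'"
  note K = alpha_kei_nanoword_kei[OF inv, of \<beta> N] and K' = alpha_kei_nanoword_kei[OF inv, of \<beta> N']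
  obtain f' where f': "colouring \<beta> ?K N' f'" "\<forall>i i'. P i i' \<longrightarrow> f' i' = ?X i"
    by (rule carried_colouring[OF carry[OF K] colouring_edge_class[OF N]])
  obtain f where f: "colouring \<beta> ?K' N f" "\<forall>i' i. P i i' \<longrightarrow> f i = ?X' i'"
    by (rule carried_colouring[OF carry'[OF K'] colouring_edge_class[OF N']])
  obtain \<phi> where \<phi>: "\<phi> \<in> kei_hom \<alpha> ?K ?K'"
    "\<forall>i\<le>length (word N). \<phi> (?X i) = f i"
    by (rule kei_hom_of_colouring[OF inv K' f(1)])
  obtain \<psi> where \<psi>: "\<psi> \<in> kei_hom \<alpha> ?K' ?K"
    "\<forall>i\<le>length (word N'). \<psi> (?X' i) = f' i"
    by (rule kei_hom_of_colouring[OF inv K f'(1)])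
  have \<phi>P: "\<phi> (?X i) = ?X' i'" and \<psi>P: "\<psi> (?X' i') = ?X i" if "P i i'" for i i'
    using \<phi>(2) \<psi>(2) f(2) f'(2) Ple[OF that] that by simp_all
  have X: "colouring \<beta> ?K N (\<lambda>i. (\<psi> \<circ> \<phi>) (?X i))"
    by (rule colouring_hom[OF N kei_hom_comp[OF \<phi>(1) \<psi>(1)] colouring_edge_class[OF N]])
  have *: "(\<psi> \<circ> \<phi>) (?X i) = ?X i" if "i \<le> length (word N)" for i
    by (rule colouring_determined[OF carry[OF K] X colouring_edge_class[OF N]])
      (simp_all add: \<phi>P \<psi>P that)
  have "(\<psi> \<circ> \<phi>) x = id x" if "x \<in> carrier ?K" for x
    by (rule presented_kei_hom_ext[OF kei_hom_comp[OF \<phi>(1) \<psi>(1), unfolded nanoword_kei_def]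
          kei_hom_id])
      (use * that in \<open>simp_all add: nanoword_kei_def edge_class_def\<close>)
  then have 1: "\<forall>x\<in>carrier ?K. \<psi> (\<phi> x) = x" by simp
  have X': "colouring \<beta> ?K' N' (\<lambda>i. (\<phi> \<circ> \<psi>) (?X' i))"
    by (rule colouring_hom[OF N' kei_hom_comp[OF \<psi>(1) \<phi>(1)] colouring_edge_class[OF N']])
  have *: "(\<phi> \<circ> \<psi>) (?X' i) = ?X' i" if "i \<le> length (word N')" for i
    by (rule colouring_determined[OF carry'[OF K'] X' colouring_edge_class[OF N']])
      (simp_all add: \<phi>P \<psi>P that)
  have "(\<phi> \<circ> \<psi>) x = id x" if "x \<in> carrier ?K'" for x
    by (rule presented_kei_hom_ext[OF kei_hom_comp[OF \<psi>(1) \<phi>(1), unfolded nanoword_kei_def]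
          kei_hom_id])
      (use * that in \<open>simp_all add: nanoword_kei_def edge_class_def\<close>)
  then have 2: "\<forall>x\<in>carrier ?K'. \<phi> (\<psi> x) = x" by simp
  have "bij_betw \<phi> (carrier ?K) (carrier ?K')"
    using \<phi>(1) \<psi>(1) by (intro bij_betw_byWitness[OF 1 2]) (auto simp: kei_hom_def)
  with \<phi>(1) \<phi>P[OF P0] \<phi>P[OF Pn] show ?thesis
    unfolding isomorphic_triples_def kei_iso_def kei_input_def kei_output_def edge_class_def
    by blast
qed

lemma isomorphic_triples_sym:
  assumes inv: "involution_on \<alpha> \<tau>" and "isomorphic_triples \<alpha> \<tau> \<beta> N N'"
  shows "isomorphic_triples \<alpha> \<tau> \<beta> N' N"
proof -
  let ?K = "nanoword_kei \<alpha> \<tau> \<beta> N" and ?K' = "nanoword_kei \<alpha> \<tau> \<beta> N'"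
  interpret K: alpha_kei \<alpha> \<tau> ?K by (rule alpha_kei_nanoword_kei[OF inv])
  obtain \<phi> where \<phi>: "\<phi> \<in> kei_hom \<alpha> ?K ?K'" and bij: "bij_betw \<phi> (carrier ?K) (carrier ?K')"
    and io: "\<phi> (kei_input \<alpha> \<tau> \<beta> N) = kei_input \<alpha> \<tau> \<beta> N'"
      "\<phi> (kei_output \<alpha> \<tau> \<beta> N) = kei_output \<alpha> \<tau> \<beta> N'"
    using assms(2) by (auto simp: isomorphic_triples_def kei_iso_def)
  define \<psi> where "\<psi> = inv_into (carrier ?K) \<phi>"
  have \<psi>\<phi>: "\<psi> (\<phi> x) = x" if "x \<in> carrier ?K" for x
    using bij that by (simp add: \<psi>_def bij_betw_inv_into_left)
  have im: "\<phi> ` carrier ?K = carrier ?K'" using bij by (rule bij_betw_imp_surj_on)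
  have "\<psi> (app ?K' a (\<phi> x)) = app ?K a (\<psi> (\<phi> x))"
    if "a \<in> \<alpha>" "x \<in> carrier ?K" for a x
  proof -
    have "app ?K' a (\<phi> x) = \<phi> (app ?K a x)" using \<phi> that by (simp add: kei_hom_def)
    with that show ?thesis by (simp add: \<psi>\<phi> K.app_closed)
  qed
  moreover have "\<psi> (star ?K' a (\<phi> x) (\<phi> y)) = star ?K a (\<psi> (\<phi> x)) (\<psi> (\<phi> y))"
    if "a \<in> \<alpha>" "x \<in> carrier ?K" "y \<in> carrier ?K" for a x y
  proof -
    have "star ?K' a (\<phi> x) (\<phi> y) = \<phi> (star ?K a x y)" using \<phi> that by (simp add: kei_hom_def)
    with that show ?thesis by (simp add: \<psi>\<phi> K.star_closed)
  qed
  ultimately have "\<psi> \<in> kei_hom \<alpha> ?K' ?K"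
    unfolding kei_hom_def im[symmetric] by (simp add: \<psi>\<phi> image_subset_iff)
  moreover have "bij_betw \<psi> (carrier ?K') (carrier ?K)"
    unfolding \<psi>_def using bij by (rule bij_betw_inv_into)
  moreover have "kei_input \<alpha> \<tau> \<beta> N \<in> carrier ?K" "kei_output \<alpha> \<tau> \<beta> N \<in> carrier ?K"
    by (auto simp: kei_input_def kei_output_def nanoword_kei_def carrier_presented_kei
        intro!: imageI kei_terms.Gen)
  ultimately show ?thesis
    using \<psi>\<phi> io unfolding isomorphic_triples_def kei_iso_def
    by (metis (mono_tags, lifting) mem_Collect_eq)
qed

lemma isomorphic_triples_refl: "isomorphic_triples \<alpha> \<tau> \<beta> N N"
  unfolding isomorphic_triples_def kei_iso_def using kei_hom_id bij_betw_id by fastforce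

lemma isomorphic_triples_trans:
  assumes "isomorphic_triples \<alpha> \<tau> \<beta> M N" "isomorphic_triples \<alpha> \<tau> \<beta> N L"
  shows "isomorphic_triples \<alpha> \<tau> \<beta> M L"
proof -
  obtain \<phi> \<psi> where
    "\<phi> \<in> kei_iso \<alpha> (nanoword_kei \<alpha> \<tau> \<beta> M) (nanoword_kei \<alpha> \<tau> \<beta> N)"
    "\<phi> (kei_input \<alpha> \<tau> \<beta> M) = kei_input \<alpha> \<tau> \<beta> N" "\<phi> (kei_output \<alpha> \<tau> \<beta> M) = kei_output \<alpha> \<tau> \<beta> N"
    "\<psi> \<in> kei_iso \<alpha> (nanoword_kei \<alpha> \<tau> \<beta> N) (nanoword_kei \<alpha> \<tau> \<beta> L)"
    "\<psi> (kei_input \<alpha> \<tau> \<beta> N) = kei_input \<alpha> \<tau> \<beta> L" "\<psi> (kei_output \<alpha> \<tau> \<beta> N) = kei_output \<alpha> \<tau> \<beta> L"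
    using assms unfolding isomorphic_triples_def by blast
  then show ?thesis
    unfolding isomorphic_triples_def kei_iso_def
    by (intro bexI[of _ "\<psi> \<circ> \<phi>"]) (auto intro: kei_hom_comp bij_betw_trans)
qed


section \<open>Invariance under isomorphism\<close>

lemma isomorphic_triples_isomorphic:
  assumes inv: "involution_on \<alpha> \<tau>" and N: "is_nanoword \<alpha> N" and N': "is_nanoword \<alpha> N'"
    and iso: "nanoword_isomorphic N N'"
  shows "isomorphic_triples \<alpha> \<tau> \<beta> N N'"
proof -
  obtain h where h: "bij_betw h (alphabet N) (alphabet N')"
    "\<forall>A\<in>alphabet N. proj N' (h A) = proj N A" "map h (word N) = word N'"
    using iso unfolding nanoword_isomorphic_def by blast
  have len: "length (word N') = length (word N)" by (simp flip: h(3))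
  have mem: "word N ! i \<in> alphabet N" if "i < length (word N)" for i
    using N that unfolding is_nanoword_def by (metis in_listsD nth_mem)
  have "colouring \<beta> K N' f \<longleftrightarrow> colouring \<beta> K N f" for K :: "('a, 'x) kei" and f
  proof -
    have "proj N' (word N' ! i) = proj N (word N ! i)"
      "word N' ! i = word N' ! j \<longleftrightarrow> word N ! i = word N ! j"
      if "i < j" "j < length (word N)" for i j
      using that h(2) h(3)[symmetric] mem[of i] mem[of j] bij_betw_imp_inj_on[OF h(1)]
      by (auto dest: inj_onD)
    then have "(word N' ! i = word N' ! j \<longrightarrow>
        crossing \<beta> K (proj N' (word N' ! i)) (f i, f (Suc i)) (f j, f (Suc j))) \<longleftrightarrow>
      (word N ! i = word N ! j \<longrightarrow>
        crossing \<beta> K (proj N (word N ! i)) (f i, f (Suc i)) (f j, f (Suc j)))"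
      if "i < j" "j < length (word N)" for i j
      using that by presburger
    then show ?thesis unfolding colouring_iff len by blast
  qed
  then show ?thesis
    by (intro isomorphic_triples_if_correspondence[where P = "\<lambda>i i'. i = i' \<and> i \<le> length (word N)"]
        inv N N') (auto simp: colourings_carry_over_def len)
qed


section \<open>Cutting out the letters of a move\<close>

lemma filter_steps_disjoint:
  assumes "set w \<inter> T = {}"
  shows "filter (\<lambda>s. fst s \<in> T) (steps w f) = []" "filter (\<lambda>s. fst s \<notin> T) (steps w f) = steps w f"
  using assms by (auto simp: filter_empty_conv filter_id_conv dest: fst_steps)

text \<open>In each of the next three lemmas the steps at the letters of the move are separated from the
  rest: the condition on the former becomes explicit, and the condition on the latter no longer
  mentions the edges inside the blocks.\<close>

lemma colouring_kink_iff:
  assumes w: "word N = x @ [A, A] @ y" "A \<notin> set x" "A \<notin> set y"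
    and k: "k = length x"
  shows "colouring \<beta> K N f \<longleftrightarrow>
     (\<forall>i\<le>length (word N). f i \<in> carrier K) \<and>
     crossing \<beta> K (proj N A) (f k, f (k + 1)) (f (k + 1), f (k + 2)) \<and>
     sorted_wrt (compatible \<beta> K (proj N)) (steps x f @ steps y (\<lambda>i. f (k + 2 + i)))"
  unfolding colouring_def sorted_wrt_compatible_split[of _ _ _ "steps (word N) f" "{A}"]
  using w(2,3) by (simp add: w(1) k filter_steps_disjoint[of _ "{A}", simplified] compatible_def)

lemma colouring_bigon_iff:
  assumes w: "word N = x @ [A, B] @ y @ [B, A] @ z" "A \<noteq> B"
    "set x \<inter> {A, B} = {}" "set y \<inter> {A, B} = {}" "set z \<inter> {A, B} = {}"
    and k: "k = length x" and l: "l = length y"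
  shows "colouring \<beta> K N f \<longleftrightarrow>
     (\<forall>i\<le>length (word N). f i \<in> carrier K) \<and>
     (crossing \<beta> K (proj N A) (f k, f (k + 1)) (f (k + l + 3), f (k + l + 4)) \<and>
      crossing \<beta> K (proj N B) (f (k + 1), f (k + 2)) (f (k + l + 2), f (k + l + 3))) \<and>
     sorted_wrt (compatible \<beta> K (proj N))
       (steps x f @ steps y (\<lambda>i. f (k + 2 + i)) @ steps z (\<lambda>i. f (k + l + 4 + i)))"
  unfolding colouring_def sorted_wrt_compatible_split[of _ _ _ "steps (word N) f" "{A, B}"]
  using w(2)
  by (auto simp: w(1) k l filter_steps_disjoint[OF w(3), simplified]
      filter_steps_disjoint[OF w(4), simplified] filter_steps_disjoint[OF w(5), simplified]
      compatible_def numeral_eq_Suc add_ac)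

lemma colouring_three_blocks_iff:
  assumes w: "word N = x @ [A, B] @ y @ [C, D] @ z @ [E, F] @ t"
    and T: "T = {A, B, C, D, E, F}"
    "set x \<inter> T = {}" "set y \<inter> T = {}" "set z \<inter> T = {}" "set t \<inter> T = {}"
    and k: "k = length x" and l: "l = k + length y + 2" and m: "m = l + length z + 2"
  shows "colouring \<beta> K N f \<longleftrightarrow>
     (\<forall>i\<le>length (word N). f i \<in> carrier K) \<and>
     sorted_wrt (compatible \<beta> K (proj N))
       [(A, f k, f (k + 1)), (B, f (k + 1), f (k + 2)),
        (C, f l, f (l + 1)), (D, f (l + 1), f (l + 2)),
        (E, f m, f (m + 1)), (F, f (m + 1), f (m + 2))] \<and>
     sorted_wrt (compatible \<beta> K (proj N))
       (steps x f @ steps y (\<lambda>i. f (k + 2 + i)) @ steps z (\<lambda>i. f (l + 2 + i)) @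
        steps t (\<lambda>i. f (m + 2 + i)))"
proof -
  have "A \<in> T" "B \<in> T" "C \<in> T" "D \<in> T" "E \<in> T" "F \<in> T" by (simp_all add: T)
  then show ?thesis
    unfolding colouring_def sorted_wrt_compatible_split[of _ _ _ "steps (word N) f" T]
    by (simp add: w k l m filter_steps_disjoint[OF T(2)] filter_steps_disjoint[OF T(3)]
        filter_steps_disjoint[OF T(4)] filter_steps_disjoint[OF T(5)] numeral_eq_Suc add_ac
        del: sorted_wrt.simps sorted_wrt2)
qed


section \<open>Solving the crossing conditions of a move\<close>

locale involutive_kei = alpha_kei +
  assumes involution: "involution_on \<alpha> \<tau>"
begin

lemma tau_closed: "a \<in> \<alpha> \<Longrightarrow> \<tau> a \<in> \<alpha>" and tau_tau: "a \<in> \<alpha> \<Longrightarrow> \<tau> (\<tau> a) = a"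
  using involution by (auto simp: involution_on_def)

lemma app_tau_app: "a \<in> \<alpha> \<Longrightarrow> x \<in> carrier K \<Longrightarrow> app K (\<tau> a) (app K a x) = x"
  using kei4[of "\<tau> a" x] by (simp add: tau_closed tau_tau)

lemma star_star_tau:
  "a \<in> \<alpha> \<Longrightarrow> x \<in> carrier K \<Longrightarrow> y \<in> carrier K \<Longrightarrow>
     star K a (star K (\<tau> a) x (app K a y)) y = x"
  using kei5[of "\<tau> a" x "app K a y"] by (simp add: tau_closed tau_tau app_tau_app app_closed)

text \<open>For \<open>a \<in> \<beta>\<close> this is the axiom \<open>ax *\<^sub>a x = x\<close>. Otherwise \<open>v = u *\<^sub>a v\<close> gives \<open>u = v *\<^sub>b av\<close>
  for \<open>b = \<tau>(a)\<close> by the fifth axiom, and this is \<open>av\<close> by the first one, as \<open>v = b(av)\<close>; the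
  converse is the first axiom again.\<close>

lemma crossing_kink:
  assumes a: "a \<in> \<alpha>" and u: "u \<in> carrier K" "v \<in> carrier K"
  shows "crossing \<beta> K a (u, v) (v, u') \<longleftrightarrow>
     u' = u \<and> v = (if a \<in> \<beta> then app K a u else app K (\<tau> a) u)"
proof (cases "a \<in> \<beta>")
  case True
  then show ?thesis using a u by (auto simp: kei1)
next
  case False
  have "app K a v = u" if "v = star K a u v"
    using kei5[of a u v] kei1[of "\<tau> a" "app K a v"] that a u
    by (simp add: tau_closed app_tau_app app_closed)
  moreover have "star K a u v = v" if "app K a v = u"
    using kei1[of a v] that a u by simp
  moreover have "app K a v = u \<longleftrightarrow> v = app K (\<tau> a) u"
    using kei4[of a u] app_tau_app[of a v] a u by auto
  ultimately show ?thesis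
    unfolding crossing_notin[OF False] if_not_P[OF False] by metis
qed

text \<open>Passing \<open>A\<close> and then \<open>B\<close> restores the colour because the operations of \<open>b\<close> and of \<open>\<tau>(b)\<close> are
  inverse to each other: for \<open>x \<mapsto> ax\<close> by the fourth axiom and for \<open>x \<mapsto> x *\<^sub>a y\<close> by the fifth. That
  \<open>a\<close> and \<open>b\<close> lie on the same side of \<open>\<beta>\<close> ensures that the operations met at either end are of the
  same kind.\<close>

lemma crossing_bigon:
  assumes b: "b \<in> \<alpha>" "a = \<tau> b" "a \<in> \<beta> \<longleftrightarrow> b \<in> \<beta>"
    and p: "p\<^sub>0 \<in> carrier K" "q\<^sub>0 \<in> carrier K"
  shows "crossing \<beta> K a (p\<^sub>0, p\<^sub>1) (q\<^sub>1, q\<^sub>2) \<and> crossing \<beta> K b (p\<^sub>1, p\<^sub>2) (q\<^sub>0, q\<^sub>1) \<longleftrightarrow>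
     p\<^sub>2 = p\<^sub>0 \<and> q\<^sub>2 = q\<^sub>0 \<and>
     p\<^sub>1 = (if a \<in> \<beta> then app K a p\<^sub>0 else star K a p\<^sub>0 (app K b q\<^sub>0)) \<and>
     q\<^sub>1 = (if a \<in> \<beta> then star K b q\<^sub>0 (app K a p\<^sub>0) else app K b q\<^sub>0)"
proof -
  have "app K b (app K a p\<^sub>0) = p\<^sub>0" "app K a (app K b q\<^sub>0) = q\<^sub>0"
    using b p by (simp_all add: kei4 app_tau_app)
  moreover have "star K a (star K b q\<^sub>0 (app K a p\<^sub>0)) p\<^sub>0 = q\<^sub>0"
    using star_star_tau[of a q\<^sub>0 p\<^sub>0] b p by (simp add: tau_closed tau_tau)
  moreover have "star K b (star K a p\<^sub>0 (app K b q\<^sub>0)) q\<^sub>0 = p\<^sub>0"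
    using star_star_tau[of b p\<^sub>0 q\<^sub>0] b p by simp
  ultimately show ?thesis using b(3) by (cases "a \<in> \<beta>") auto
qed

end

text \<open>The relation between the colours at the ends of the three blocks of the third move, which
  both versions of the blocks turn out to impose. The three pairs belong to the blocks in the
  order of the word; each consists of the colours before and after the block.\<close>

definition triangle_ends ::
  "'a set \<Rightarrow> ('a, 'x) kei \<Rightarrow> 'a \<Rightarrow> 'x \<times> 'x \<Rightarrow> 'x \<times> 'x \<Rightarrow> 'x \<times> 'x \<Rightarrow> bool" where
  "triangle_ends \<beta> K a = (\<lambda>(p\<^sub>0, p\<^sub>2) (q\<^sub>0, q\<^sub>2) (r\<^sub>0, r\<^sub>2).
     if a \<in> \<beta>
     then p\<^sub>2 = app K a (app K a p\<^sub>0) \<and> q\<^sub>2 = app K a (star K a q\<^sub>0 p\<^sub>0) \<and>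
       r\<^sub>2 = star K a (star K a r\<^sub>0 q\<^sub>0) p\<^sub>0
     else p\<^sub>2 = star K a (star K a p\<^sub>0 q\<^sub>0) r\<^sub>0 \<and> q\<^sub>2 = app K a (star K a q\<^sub>0 r\<^sub>0) \<and>
       r\<^sub>2 = app K a (app K a r\<^sub>0))"

context alpha_kei
begin

text \<open>The two versions of the third move, with blocks \<open>AB, AC, BC\<close> and \<open>BA, CA, CB\<close>. The middle
  edge of each block is determined by the ends, and eliminating the middle edges leaves relations
  that differ only by the second and the third axiom. For \<open>a \<in> \<beta>\<close>, the third axiom rewrites the
  outcome of the first version and the second axiom that of the second; for \<open>a \<notin> \<beta>\<close> it is the
  other way round.\<close>

lemma crossing_triangle:
  assumes a: "a \<in> \<alpha>" and p: "p\<^sub>0 \<in> carrier K" "q\<^sub>0 \<in> carrier K" "r\<^sub>0 \<in> carrier K"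
  shows "crossing \<beta> K a (p\<^sub>0, p\<^sub>1) (q\<^sub>0, q\<^sub>1) \<and> crossing \<beta> K a (p\<^sub>1, p\<^sub>2) (r\<^sub>0, r\<^sub>1) \<and>
       crossing \<beta> K a (q\<^sub>1, q\<^sub>2) (r\<^sub>1, r\<^sub>2) \<longleftrightarrow>
     triangle_ends \<beta> K a (p\<^sub>0, p\<^sub>2) (q\<^sub>0, q\<^sub>2) (r\<^sub>0, r\<^sub>2) \<and>
     p\<^sub>1 = (if a \<in> \<beta> then app K a p\<^sub>0 else star K a p\<^sub>0 q\<^sub>0) \<and>
     q\<^sub>1 = (if a \<in> \<beta> then star K a q\<^sub>0 p\<^sub>0 else app K a q\<^sub>0) \<and>
     r\<^sub>1 = (if a \<in> \<beta> then star K a r\<^sub>0 (app K a p\<^sub>0) else app K a r\<^sub>0)"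
  using a p kei2[of a q\<^sub>0 r\<^sub>0] kei3[of a r\<^sub>0 q\<^sub>0 p\<^sub>0]
  by (cases "a \<in> \<beta>") (auto simp: triangle_ends_def)

lemma crossing_triangle_flipped:
  assumes a: "a \<in> \<alpha>" and p: "p\<^sub>0 \<in> carrier K" "q\<^sub>0 \<in> carrier K" "r\<^sub>0 \<in> carrier K"
  shows "crossing \<beta> K a (p\<^sub>1, p\<^sub>2) (q\<^sub>1, q\<^sub>2) \<and> crossing \<beta> K a (p\<^sub>0, p\<^sub>1) (r\<^sub>1, r\<^sub>2) \<and>
       crossing \<beta> K a (q\<^sub>0, q\<^sub>1) (r\<^sub>0, r\<^sub>1) \<longleftrightarrow>
     triangle_ends \<beta> K a (p\<^sub>0, p\<^sub>2) (q\<^sub>0, q\<^sub>2) (r\<^sub>0, r\<^sub>2) \<and>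
     p\<^sub>1 = (if a \<in> \<beta> then app K a p\<^sub>0 else star K a p\<^sub>0 (app K a r\<^sub>0)) \<and>
     q\<^sub>1 = (if a \<in> \<beta> then app K a q\<^sub>0 else star K a q\<^sub>0 r\<^sub>0) \<and>
     r\<^sub>1 = (if a \<in> \<beta> then star K a r\<^sub>0 q\<^sub>0 else app K a r\<^sub>0)"
  using a p kei2[of a q\<^sub>0 p\<^sub>0] kei3[of a p\<^sub>0 q\<^sub>0 r\<^sub>0]
  by (cases "a \<in> \<beta>") (auto simp: triangle_ends_def)

end


section \<open>Invariance under the three moves\<close>

lemma involutive_kei_intro:
  "alpha_kei \<alpha> \<tau> K \<Longrightarrow> involution_on \<alpha> \<tau> \<Longrightarrow> involutive_kei \<alpha> \<tau> K"
  by (simp add: involutive_kei_def involutive_kei_axioms_def)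

text \<open>Here \<open>k\<close> is the edge in front of the deleted letters. The edges \<open>k\<close> and \<open>k + 2\<close> of the
  longer word have equal colours and both become the edge \<open>k\<close> of the shorter one; the edge \<open>k + 1\<close>
  disappears, and its colour is recovered by a formula \<open>e\<close>.\<close>

lemma carry_over_kink:
  assumes K: "alpha_kei \<alpha> \<tau> K" and inv: "involution_on \<alpha> \<tau>" and a: "proj N A \<in> \<alpha>"
    and w: "word N = x @ [A, A] @ y" "A \<notin> set x" "A \<notin> set y"
    and w': "word N' = x @ y" "proj N' = proj N"
    and k: "k = length x" and l: "l = length y"
    and P: "P = (\<lambda>i i'. i' = i \<and> i \<le> k \<or> i = i' + 2 \<and> k \<le> i' \<and> i' \<le> k + l)"
  shows "colourings_carry_over \<beta> K P N N'" "colourings_carry_over \<beta> K (\<lambda>i' i. P i i') N' N"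
proof -
  interpret involutive_kei \<alpha> \<tau> K using K inv by (rule involutive_kei_intro)
  define e where
    "e f = (if proj N A \<in> \<beta> then app K (proj N A) (f k) else app K (\<tau> (proj N A)) (f k))" for f
  have len: "length (word N) = k + 2 + l" "length (word N') = k + l"
    by (simp_all add: w w' k l)
  have e_closed: "e f \<in> carrier K" if "f k \<in> carrier K" for f
    using that a by (simp add: e_def app_closed tau_closed)
  have N: "colouring \<beta> K N f \<longleftrightarrow>
      (\<forall>i\<le>k + 2 + l. f i \<in> carrier K) \<and> f (k + 2) = f k \<and> f (k + 1) = e f \<and>
      sorted_wrt (compatible \<beta> K (proj N)) (steps x f @ steps y (\<lambda>i. f (k + 2 + i)))" for f
  proof -
    have "crossing \<beta> K (proj N A) (f k, f (k + 1)) (f (k + 1), f (k + 2)) \<longleftrightarrow>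
        f (k + 2) = f k \<and> f (k + 1) = e f"
      if "\<forall>i\<le>k + 2 + l. f i \<in> carrier K"
      unfolding e_def using that by (intro crossing_kink[OF a]) simp_all
    then show ?thesis unfolding colouring_kink_iff[OF w k] len by blast
  qed
  have N': "colouring \<beta> K N' f \<longleftrightarrow>
      (\<forall>i\<le>k + l. f i \<in> carrier K) \<and>
      sorted_wrt (compatible \<beta> K (proj N)) (steps x f @ steps y (\<lambda>i. f (k + i)))" for f
    unfolding colouring_def len by (simp add: w' k)
  have outer: "steps x f' @ steps y (\<lambda>i. f' (k + i)) = steps x f @ steps y (\<lambda>i. f (k + 2 + i))"
    if "\<And>i i'. P i i' \<longrightarrow> f' i' = f i" for f f'
    by (intro arg_cong2[where f = "(@)"] steps_cong that[rule_format]) (auto simp: P k l)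
  have "\<exists>f'. colouring \<beta> K N' f' \<and> (\<forall>i i'. P i i' \<longrightarrow> f' i' = f i)" if f: "colouring \<beta> K N f" for f
  proof -
    define f' where "f' i = (if i \<le> k then f i else f (i + 2))" for i
    have agree: "P i i' \<longrightarrow> f' i' = f i" for i i'
      using f by (cases "i' = k") (auto simp: N P f'_def)
    have "\<forall>i\<le>k + l. f' i \<in> carrier K" using f by (simp add: N f'_def)
    with f have "colouring \<beta> K N' f'" unfolding N N' outer[OF agree] by simp
    with agree show ?thesis by blast
  qed
  moreover have "f i = g i"
    if f: "colouring \<beta> K N f" and g: "colouring \<beta> K N g"
      and agree: "\<forall>i i'. P i i' \<longrightarrow> f i = g i" and i: "i \<le> k + 2 + l" for f g i
  proof -
    consider "i \<le> k" | "i = k + 1" | "k + 2 \<le> i" by linarith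
    then show ?thesis
    proof cases
      case 1
      then have "P i i" by (simp add: P)
      with agree show ?thesis by blast
    next
      case 2
      have "P k k" by (simp add: P)
      with agree have "f k = g k" by blast
      then have "e f = e g" by (simp add: e_def)
      with f g 2 show ?thesis by (simp add: N)
    next
      case 3
      with i have "P i (i - 2)" by (auto simp: P)
      with agree show ?thesis by blast
    qed
  qed
  ultimately show "colourings_carry_over \<beta> K P N N'"
    unfolding colourings_carry_over_def len by blast
  have "\<exists>f. colouring \<beta> K N f \<and> (\<forall>i' i. P i i' \<longrightarrow> f i = f' i')" if f': "colouring \<beta> K N' f'" for f'
  proof -
    define f where "f i = (if i \<le> k then f' i else if i = k + 1 then e f' else f' (i - 2))" for i
    have agree: "P i i' \<longrightarrow> f' i' = f i" for i i'
      by (auto simp: P f_def)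
    have "f (k + 2) = f k" "f (k + 1) = e f" by (simp_all add: f_def e_def)
    moreover have "\<forall>i\<le>k + 2 + l. f i \<in> carrier K"
      using f' e_closed[of f'] by (simp add: f_def N')
    ultimately have "colouring \<beta> K N f"
      using f' unfolding N N' outer[OF agree] by simp
    with agree show ?thesis by metis
  qed
  moreover have "f i' = g i'" if "\<forall>i' i. P i i' \<longrightarrow> f i' = g i'" and "i' \<le> k + l"
    for f g :: "nat \<Rightarrow> 'b" and i'
  proof -
    have "P i' i' \<or> P (i' + 2) i'" using that(2) by (auto simp: P)
    with that(1) show ?thesis by blast
  qed
  ultimately show "colourings_carry_over \<beta> K (\<lambda>i' i. P i i') N' N"
    unfolding colourings_carry_over_def len by blast
qed

text \<open>As for the first move, with two deleted blocks; they start after the edges \<open>k\<close> and \<open>k + l +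
  2\<close> of the longer word, and the colours of their middle edges \<open>k + 1\<close> and \<open>k + l + 3\<close> are
  recovered by formulas \<open>d\<close> and \<open>e\<close>.\<close>

lemma carry_over_bigon:
  assumes K: "alpha_kei \<alpha> \<tau> K" and inv: "involution_on \<alpha> \<tau>"
    and ab: "proj N B \<in> \<alpha>" "proj N A = \<tau> (proj N B)" "proj N A \<in> \<beta> \<longleftrightarrow> proj N B \<in> \<beta>"
    and w: "word N = x @ [A, B] @ y @ [B, A] @ z" "A \<noteq> B"
      "set x \<inter> {A, B} = {}" "set y \<inter> {A, B} = {}" "set z \<inter> {A, B} = {}"
    and w': "word N' = x @ y @ z" "proj N' = proj N"
    and k: "k = length x" and l: "l = length y" and m: "m = length z"
    and P: "P = (\<lambda>i i'. i' = i \<and> i \<le> k \<or> i = i' + 2 \<and> k \<le> i' \<and> i' \<le> k + l \<or>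
      i = i' + 4 \<and> k + l \<le> i' \<and> i' \<le> k + l + m)"
  shows "colourings_carry_over \<beta> K P N N'" "colourings_carry_over \<beta> K (\<lambda>i' i. P i i') N' N"
proof -
  interpret involutive_kei \<alpha> \<tau> K using K inv by (rule involutive_kei_intro)
  define a where "a = proj N A"
  define b where "b = proj N B"
  have ab: "a \<in> \<alpha>" "b \<in> \<alpha>" "a = \<tau> b" "a \<in> \<beta> \<longleftrightarrow> b \<in> \<beta>"
    using ab tau_closed by (simp_all add: a_def b_def)
  define d where "d u v = (if a \<in> \<beta> then app K a u else star K a u (app K b v))" for u v
  define e where "e u v = (if a \<in> \<beta> then star K b v (app K a u) else app K b v)" for u v
  have len: "length (word N) = k + l + 4 + m" "length (word N') = k + l + m"
    by (simp_all add: w w' k l m)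
  have de_closed: "d u v \<in> carrier K" "e u v \<in> carrier K"
    if "u \<in> carrier K" "v \<in> carrier K" for u v
    using that ab by (simp_all add: d_def e_def app_closed star_closed)
  have N: "colouring \<beta> K N f \<longleftrightarrow>
      (\<forall>i\<le>k + l + 4 + m. f i \<in> carrier K) \<and> f (k + 2) = f k \<and> f (k + l + 4) = f (k + l + 2) \<and>
      f (k + 1) = d (f k) (f (k + l + 2)) \<and> f (k + l + 3) = e (f k) (f (k + l + 2)) \<and>
      sorted_wrt (compatible \<beta> K (proj N))
        (steps x f @ steps y (\<lambda>i. f (k + 2 + i)) @ steps z (\<lambda>i. f (k + l + 4 + i)))" for f
  proof -
    have "crossing \<beta> K a (f k, f (k + 1)) (f (k + l + 3), f (k + l + 4)) \<and>
        crossing \<beta> K b (f (k + 1), f (k + 2)) (f (k + l + 2), f (k + l + 3)) \<longleftrightarrow>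
        f (k + 2) = f k \<and> f (k + l + 4) = f (k + l + 2) \<and>
        f (k + 1) = d (f k) (f (k + l + 2)) \<and> f (k + l + 3) = e (f k) (f (k + l + 2))"
      if "\<forall>i\<le>k + l + 4 + m. f i \<in> carrier K"
      unfolding d_def e_def using that by (intro crossing_bigon ab) simp_all
    then show ?thesis
      unfolding colouring_bigon_iff[OF w k l] len a_def[symmetric] b_def[symmetric] by blast
  qed
  have N': "colouring \<beta> K N' f \<longleftrightarrow>
      (\<forall>i\<le>k + l + m. f i \<in> carrier K) \<and>
      sorted_wrt (compatible \<beta> K (proj N))
        (steps x f @ steps y (\<lambda>i. f (k + i)) @ steps z (\<lambda>i. f (k + l + i)))" for f
    unfolding colouring_def len by (simp add: w' k l add_ac)
  have outer: "steps x f' @ steps y (\<lambda>i. f' (k + i)) @ steps z (\<lambda>i. f' (k + l + i)) =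
      steps x f @ steps y (\<lambda>i. f (k + 2 + i)) @ steps z (\<lambda>i. f (k + l + 4 + i))"
    if "\<And>i i'. P i i' \<longrightarrow> f' i' = f i" for f f'
    by (intro arg_cong2[where f = "(@)"] steps_cong that[rule_format]) (auto simp: P k l m)
  have "\<exists>f'. colouring \<beta> K N' f' \<and> (\<forall>i i'. P i i' \<longrightarrow> f' i' = f i)" if f: "colouring \<beta> K N f" for f
  proof -
    \<comment> \<open>At the seams \<open>k\<close> and \<open>k + l\<close>, which may coincide, \<open>f'\<close> takes the colour in front of the
      deleted block.\<close>
    define f' where "f' i = (if i \<le> k then f i else if i \<le> k + l then f (i + 2) else f (i + 4))" for i
    have eq: "f (k + 2) = f k" "f (k + l + 4) = f (k + l + 2)" using f by (simp_all add: N)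
    have agree: "P i i' \<longrightarrow> f' i' = f i" for i i'
    proof
      assume "P i i'"
      then consider "i' = i" "i \<le> k" | "i = i' + 2" "i' = k" | "i = i' + 2" "k < i'" "i' \<le> k + l"
        | "i = i' + 4" "i' = k + l" | "i = i' + 4" "k + l < i'"
        unfolding P by linarith
      then show "f' i' = f i"
        by cases (use eq in \<open>auto simp: f'_def\<close>)
    qed
    have "\<forall>i\<le>k + l + m. f' i \<in> carrier K" using f by (simp add: N f'_def)
    with f have "colouring \<beta> K N' f'" unfolding N N' outer[OF agree] by simp
    with agree show ?thesis by blast
  qed
  moreover have "f i = g i"
    if f: "colouring \<beta> K N f" and g: "colouring \<beta> K N g"
      and agree: "\<forall>i i'. P i i' \<longrightarrow> f i = g i" and i: "i \<le> k + l + 4 + m" for f g i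
  proof -
    have "P k k" "P (k + l + 2) (k + l)" by (simp_all add: P)
    with agree have eq: "f k = g k" "f (k + l + 2) = g (k + l + 2)" by blast+
    consider "i \<le> k" | "i = k + 1" | "k + 2 \<le> i" "i \<le> k + l + 2" | "i = k + l + 3" | "k + l + 4 \<le> i"
      by linarith
    then show ?thesis
    proof cases
      case 1
      then have "P i i" by (simp add: P)
      with agree show ?thesis by blast
    next
      case 2
      with f g eq show ?thesis by (simp add: N)
    next
      case 3
      with i have "P i (i - 2)" by (auto simp: P)
      with agree show ?thesis by blast
    next
      case 4
      with f g eq show ?thesis by (simp add: N)
    next
      case 5
      with i have "P i (i - 4)" by (auto simp: P)
      with agree show ?thesis by blast
    qed
  qed
  ultimately show "colourings_carry_over \<beta> K P N N'"
    unfolding colourings_carry_over_def len by blast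
  have "\<exists>f. colouring \<beta> K N f \<and> (\<forall>i' i. P i i' \<longrightarrow> f i = f' i')" if f': "colouring \<beta> K N' f'" for f'
  proof -
    define f where "f i = (if i \<le> k then f' i else if i = k + 1 then d (f' k) (f' (k + l))
      else if i \<le> k + l + 2 then f' (i - 2) else if i = k + l + 3 then e (f' k) (f' (k + l))
      else f' (i - 4))" for i
    have agree: "P i i' \<longrightarrow> f' i' = f i" for i i'
      by (auto simp: P f_def)
    have "f (k + 2) = f k" "f (k + l + 4) = f (k + l + 2)"
      "f (k + 1) = d (f k) (f (k + l + 2))" "f (k + l + 3) = e (f k) (f (k + l + 2))"
      by (simp_all add: f_def)
    moreover have "\<forall>i\<le>k + l + 4 + m. f i \<in> carrier K"
      using f' de_closed[of "f' k" "f' (k + l)"] by (simp add: f_def N')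
    ultimately have "colouring \<beta> K N f"
      using f' unfolding N N' outer[OF agree] by simp
    with agree show ?thesis by metis
  qed
  moreover have "f i' = g i'" if "\<forall>i' i. P i i' \<longrightarrow> f i' = g i'" and "i' \<le> k + l + m"
    for f g :: "nat \<Rightarrow> 'b" and i'
  proof -
    have "P i' i' \<or> P (i' + 2) i' \<or> P (i' + 4) i'" using that(2) by (auto simp: P)
    with that(1) show ?thesis by blast
  qed
  ultimately show "colourings_carry_over \<beta> K (\<lambda>i' i. P i i') N' N"
    unfolding colourings_carry_over_def len by blast
qed

text \<open>The third move keeps all edges, so colourings can be carried over by giving new colours to
  the middle edges \<open>M\<close> of the three blocks. This works since the two words impose the same
  condition \<open>C\<close> on the remaining edges and determine the colours on \<open>M\<close> by formulas \<open>e\<close> and \<open>e'\<close>.\<close>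

lemma carry_over_recolouring:
  assumes N: "\<And>f. colouring \<beta> K N f \<longleftrightarrow> C f \<and> (\<forall>i\<in>M. f i = e f i)"
    and N': "\<And>f. colouring \<beta> K N' f \<longleftrightarrow> C f \<and> (\<forall>i\<in>M. f i = e' f i)"
    and off: "\<And>f g. (\<And>i. i \<le> length (word N) \<Longrightarrow> i \<notin> M \<Longrightarrow> f i = g i) \<Longrightarrow>
      (C f \<longleftrightarrow> C g) \<and> (\<forall>i\<in>M. e f i = e g i \<and> e' f i = e' g i)"
  shows "colourings_carry_over \<beta> K (\<lambda>i i'. i = i' \<and> i \<le> length (word N) \<and> i \<notin> M) N N'"
  unfolding colourings_carry_over_def
proof (intro conjI allI impI)
  fix f assume f: "colouring \<beta> K N f"
  define f' where "f' i = (if i \<in> M then e' f i else f i)" for i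
  have "(C f' \<longleftrightarrow> C f) \<and> (\<forall>i\<in>M. e f' i = e f i \<and> e' f' i = e' f i)"
    by (rule off) (simp add: f'_def)
  with f have "colouring \<beta> K N' f'" by (simp add: N N' f'_def)
  then show "\<exists>f'. colouring \<beta> K N' f' \<and>
      (\<forall>i i'. i = i' \<and> i \<le> length (word N) \<and> i \<notin> M \<longrightarrow> f' i' = f i)"
    by (intro exI[of _ f']) (simp add: f'_def)
next
  fix f g i
  assume f: "colouring \<beta> K N f" and g: "colouring \<beta> K N g"
    and agree: "\<forall>i i'. i = i' \<and> i \<le> length (word N) \<and> i \<notin> M \<longrightarrow> f i = g i"
    and i: "i \<le> length (word N)"
  have "(C f \<longleftrightarrow> C g) \<and> (\<forall>i\<in>M. e f i = e g i \<and> e' f i = e' g i)"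
    using agree by (intro off) simp
  then show "f i = g i" using f g agree i by (cases "i \<in> M") (auto simp: N)
qed

lemma carry_over_triangle:
  assumes K: "alpha_kei \<alpha> \<tau> K"
    and a: "a \<in> \<alpha>" "proj N A = a" "proj N B = a" "proj N C = a"
    and ABC: "A \<noteq> B" "A \<noteq> C" "B \<noteq> C" and T: "T = {A, B, C}"
    and w: "word N = x @ [A, B] @ y @ [A, C] @ z @ [B, C] @ t"
    and w': "word N' = x @ [B, A] @ y @ [C, A] @ z @ [C, B] @ t" "proj N' = proj N"
    and disj: "set x \<inter> T = {}" "set y \<inter> T = {}" "set z \<inter> T = {}" "set t \<inter> T = {}"
    and k: "k = length x" and l: "l = k + length y + 2" and m: "m = l + length z + 2"
    and P: "P = (\<lambda>i i'. i = i' \<and> i \<le> length (word N) \<and> i \<notin> {k + 1, l + 1, m + 1})"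
  shows "colourings_carry_over \<beta> K P N N'" "colourings_carry_over \<beta> K P N' N"
proof -
  interpret alpha_kei \<alpha> \<tau> K by (fact K)
  let ?M = "{k + 1, l + 1, m + 1}"
  define n where "n = length (word N)"
  have n: "n = m + 2 + length t" by (simp add: n_def w k l m)
  define Q where "Q f \<longleftrightarrow> (\<forall>i\<le>n. i \<notin> ?M \<longrightarrow> f i \<in> carrier K) \<and>
      triangle_ends \<beta> K a (f k, f (k + 2)) (f l, f (l + 2)) (f m, f (m + 2)) \<and>
      sorted_wrt (compatible \<beta> K (proj N))
       (steps x f @ steps y (\<lambda>i. f (k + 2 + i)) @ steps z (\<lambda>i. f (l + 2 + i)) @
        steps t (\<lambda>i. f (m + 2 + i)))" for f
  \<comment> \<open>The colours of the middle edges of the blocks before and after the move.\<close>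
  define e where "e f i =
    (if i = k + 1 then if a \<in> \<beta> then app K a (f k) else star K a (f k) (f l)
     else if i = l + 1 then if a \<in> \<beta> then star K a (f l) (f k) else app K a (f l)
     else if a \<in> \<beta> then star K a (f m) (app K a (f k)) else app K a (f m))" for f i
  define e' where "e' f i =
    (if i = k + 1 then if a \<in> \<beta> then app K a (f k) else star K a (f k) (app K a (f m))
     else if i = l + 1 then if a \<in> \<beta> then app K a (f l) else star K a (f l) (f m)
     else if a \<in> \<beta> then star K a (f m) (f l) else app K a (f m))" for f i
  have e_closed: "e f i \<in> carrier K" "e' f i \<in> carrier K"
    if "Q f" for f i
  proof -
    have "f k \<in> carrier K" "f l \<in> carrier K" "f m \<in> carrier K"
      using that by (simp_all add: Q_def n k l m)
    with a(1) show "e f i \<in> carrier K" "e' f i \<in> carrier K"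
      by (simp_all add: e_def e'_def app_closed star_closed)
  qed
  have T': "T = {A, B, A, C, B, C}" by (auto simp: T)
  have N: "colouring \<beta> K N f \<longleftrightarrow> Q f \<and> (\<forall>i\<in>?M. f i = e f i)" for f
  proof -
    have "sorted_wrt (compatible \<beta> K (proj N))
       [(A, f k, f (k + 1)), (B, f (k + 1), f (k + 2)),
        (A, f l, f (l + 1)), (C, f (l + 1), f (l + 2)),
        (B, f m, f (m + 1)), (C, f (m + 1), f (m + 2))] \<longleftrightarrow>
      triangle_ends \<beta> K a (f k, f (k + 2)) (f l, f (l + 2)) (f m, f (m + 2)) \<and>
      (\<forall>i\<in>?M. f i = e f i)" (is "?inner \<longleftrightarrow> ?solved")
      if "\<forall>i\<le>n. f i \<in> carrier K"
    proof -
      have "?inner \<longleftrightarrow> crossing \<beta> K a (f k, f (k + 1)) (f l, f (l + 1)) \<and>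
        crossing \<beta> K a (f (k + 1), f (k + 2)) (f m, f (m + 1)) \<and>
        crossing \<beta> K a (f (l + 1), f (l + 2)) (f (m + 1), f (m + 2))"
        using ABC a by (auto simp: compatible_def)
      also have "\<dots> \<longleftrightarrow> ?solved"
        using that by (subst crossing_triangle[OF a(1)]) (simp_all add: e_def n l m)
      finally show ?thesis .
    qed
    moreover have "(\<forall>i\<le>n. f i \<in> carrier K) \<longleftrightarrow> (\<forall>i\<le>n. i \<notin> ?M \<longrightarrow> f i \<in> carrier K)"
      if "Q f" "\<forall>i\<in>?M. f i = e f i"
      using e_closed[OF that(1)] that(2) by metis
    ultimately show ?thesis
      unfolding colouring_three_blocks_iff[OF w T' disj k l m] n_def[symmetric] Q_def by blast
  qed
  have T': "T = {B, A, C, A, C, B}" by (auto simp: T)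
  have n': "length (word N') = n" by (simp add: n_def w w')
  have N': "colouring \<beta> K N' f \<longleftrightarrow> Q f \<and> (\<forall>i\<in>?M. f i = e' f i)" for f
  proof -
    have "sorted_wrt (compatible \<beta> K (proj N))
       [(B, f k, f (k + 1)), (A, f (k + 1), f (k + 2)),
        (C, f l, f (l + 1)), (A, f (l + 1), f (l + 2)),
        (C, f m, f (m + 1)), (B, f (m + 1), f (m + 2))] \<longleftrightarrow>
      triangle_ends \<beta> K a (f k, f (k + 2)) (f l, f (l + 2)) (f m, f (m + 2)) \<and>
      (\<forall>i\<in>?M. f i = e' f i)" (is "?inner \<longleftrightarrow> ?solved")
      if "\<forall>i\<le>n. f i \<in> carrier K"
    proof -
      have "?inner \<longleftrightarrow> crossing \<beta> K a (f (k + 1), f (k + 2)) (f (l + 1), f (l + 2)) \<and>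
        crossing \<beta> K a (f k, f (k + 1)) (f (m + 1), f (m + 2)) \<and>
        crossing \<beta> K a (f l, f (l + 1)) (f m, f (m + 1))"
        using ABC a by (auto simp: compatible_def)
      also have "\<dots> \<longleftrightarrow> ?solved"
        using that by (subst crossing_triangle_flipped[OF a(1)]) (simp_all add: e'_def n l m)
      finally show ?thesis .
    qed
    moreover have "(\<forall>i\<le>n. f i \<in> carrier K) \<longleftrightarrow> (\<forall>i\<le>n. i \<notin> ?M \<longrightarrow> f i \<in> carrier K)"
      if "Q f" "\<forall>i\<in>?M. f i = e' f i"
      using e_closed[OF that(1)] that(2) by metis
    ultimately show ?thesis
      unfolding colouring_three_blocks_iff[OF w'(1) T' disj k l m] w'(2) n' Q_def by blast
  qed
  have off: "(Q f \<longleftrightarrow> Q g) \<and> (\<forall>i\<in>?M. e f i = e g i \<and> e' f i = e' g i)"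
    if eq: "\<And>i. i \<le> n \<Longrightarrow> i \<notin> ?M \<Longrightarrow> f i = g i" for f g
  proof -
    have ends: "f k = g k" "f (k + 2) = g (k + 2)" "f l = g l" "f (l + 2) = g (l + 2)"
      "f m = g m" "f (m + 2) = g (m + 2)"
      by (rule eq; simp add: n k l m)+
    have "steps x f @ steps y (\<lambda>i. f (k + 2 + i)) @ steps z (\<lambda>i. f (l + 2 + i)) @
        steps t (\<lambda>i. f (m + 2 + i)) =
      steps x g @ steps y (\<lambda>i. g (k + 2 + i)) @ steps z (\<lambda>i. g (l + 2 + i)) @
        steps t (\<lambda>i. g (m + 2 + i))"
      by (intro arg_cong2[where f = "(@)"] steps_cong eq) (simp_all add: n k l m)
    moreover have "(\<forall>i\<le>n. i \<notin> ?M \<longrightarrow> f i \<in> carrier K) \<longleftrightarrow> (\<forall>i\<le>n. i \<notin> ?M \<longrightarrow> g i \<in> carrier K)"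
      using eq by metis
    ultimately show ?thesis unfolding Q_def e_def e'_def ends by simp
  qed
  show "colourings_carry_over \<beta> K P N N'"
    unfolding P by (rule carry_over_recolouring[where C = Q, OF N N']) (rule off, simp add: n_def)
  show "colourings_carry_over \<beta> K P N' N"
    unfolding P n_def[symmetric] n'[symmetric]
  proof (rule carry_over_recolouring[where C = Q, OF N' N])
    fix f g :: "nat \<Rightarrow> 'b"
    assume "\<And>i. i \<le> length (word N') \<Longrightarrow> i \<notin> ?M \<Longrightarrow> f i = g i"
    then have "(Q f \<longleftrightarrow> Q g) \<and> (\<forall>i\<in>?M. e f i = e g i \<and> e' f i = e' g i)"
      by (intro off) (simp add: n')
    then show "(Q f \<longleftrightarrow> Q g) \<and> (\<forall>i\<in>?M. e' f i = e' g i \<and> e f i = e g i)" by blast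
  qed
qed

lemma is_nanoword_proj: "is_nanoword \<alpha> N \<Longrightarrow> A \<in> alphabet N \<Longrightarrow> proj N A \<in> \<alpha>"
  by (auto simp: is_nanoword_def)

lemma isomorphic_triples_move:
  assumes inv: "involution_on \<alpha> \<tau>" and \<beta>: "\<tau> ` \<beta> = \<beta>"
    and N: "is_nanoword \<alpha> N" and N': "is_nanoword \<alpha> N'" and move: "homotopy_move \<alpha> \<tau> N N'"
  shows "isomorphic_triples \<alpha> \<tau> \<beta> N N'"
  using move
proof cases
  case (move1 S p x A y)
  define P where "P = (\<lambda>i i'. i' = i \<and> i \<le> length x \<or>
    i = i' + 2 \<and> length x \<le> i' \<and> i' \<le> length x + length y)"
  have "proj N A \<in> \<alpha>" using is_nanoword_proj[OF N] move1 by simp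
  moreover have "A \<notin> set x" "A \<notin> set y" using move1 by auto
  ultimately have "colourings_carry_over \<beta> K P N N'"
      "colourings_carry_over \<beta> K (\<lambda>i' i. P i i') N' N"
    if "alpha_kei \<alpha> \<tau> K" for K :: "('a, ('a, nat) kei_term set) kei"
    using carry_over_kink[OF that inv _ _ _ _ _ _ HOL.refl HOL.refl P_def] move1 by simp_all
  then show ?thesis
    by (intro isomorphic_triples_if_correspondence[where P = P] inv N N') (auto simp: P_def move1)
next
  case (move2 S p x A B y z)
  define P where "P = (\<lambda>i i'. i' = i \<and> i \<le> length x \<or>
    i = i' + 2 \<and> length x \<le> i' \<and> i' \<le> length x + length y \<or>
    i = i' + 4 \<and> length x + length y \<le> i' \<and> i' \<le> length x + length y + length z)"
  have B: "proj N B \<in> \<alpha>" using is_nanoword_proj[OF N] move2 by simp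
  have A: "proj N A = \<tau> (proj N B)" using move2 by simp
  \<comment> \<open>This is where the invariance of \<open>\<beta>\<close> under \<open>\<tau>\<close> enters.\<close>
  have "proj N A \<in> \<beta> \<longleftrightarrow> proj N B \<in> \<beta>"
    using \<beta> inv A B unfolding involution_on_def by (metis imageI)
  moreover have "set x \<inter> {A, B} = {}" "set y \<inter> {A, B} = {}" "set z \<inter> {A, B} = {}"
    using move2 by auto
  ultimately have "colourings_carry_over \<beta> K P N N'"
      "colourings_carry_over \<beta> K (\<lambda>i' i. P i i') N' N"
    if "alpha_kei \<alpha> \<tau> K" for K :: "('a, ('a, nat) kei_term set) kei"
    using carry_over_bigon[OF that inv B A _ _ _ _ _ _ _ _ HOL.refl HOL.refl HOL.refl P_def] move2
    by simp_all
  then show ?thesis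
    by (intro isomorphic_triples_if_correspondence[where P = P] inv N N') (auto simp: P_def move2)
next
  case (move3 S p x A B y C z t)
  define k where "k = length x"
  define l where "l = k + length y + 2"
  define m where "m = l + length z + 2"
  define P where "P = (\<lambda>i i'. i = i' \<and> i \<le> length (word N) \<and> i \<notin> {k + 1, l + 1, m + 1})"
  have "p A \<in> \<alpha>" using is_nanoword_proj[OF N] move3 by simp
  moreover have "set x \<inter> {A, B, C} = {}" "set y \<inter> {A, B, C} = {}" "set z \<inter> {A, B, C} = {}"
    "set t \<inter> {A, B, C} = {}" using move3 by auto
  ultimately have "colourings_carry_over \<beta> K P N N'"
      "colourings_carry_over \<beta> K P N' N"
    if "alpha_kei \<alpha> \<tau> K" for K :: "('a, ('a, nat) kei_term set) kei"
    using carry_over_triangle[OF that _ _ _ _ _ _ _ HOL.refl _ _ _ _ _ _ _ k_def l_def m_def P_def,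
        where a = "p A" and A = A and B = B and C = C and t = t] move3 by simp_all
  moreover have "P = (\<lambda>i' i. P i i')" by (auto simp: P_def fun_eq_iff)
  ultimately show ?thesis
    by (intro isomorphic_triples_if_correspondence[where P = P] inv N N')
      (auto simp: P_def k_def l_def m_def move3)
qed

theorem theorem8p2:
  fixes \<alpha> \<beta> :: "'a set" and \<tau> :: "'a \<Rightarrow> 'a" and w w' :: "('l, 'a) nanoword"
  assumes "involution_on \<alpha> \<tau>"
    and "\<beta> \<subseteq> \<alpha>" and "\<tau> ` \<beta> = \<beta>"
    and "is_nanoword \<alpha> w" and "is_nanoword \<alpha> w'"
    and "homotopic \<alpha> \<tau> w w'"
  shows "\<exists>\<phi> \<in> kei_iso \<alpha> (nanoword_kei \<alpha> \<tau> \<beta> w) (nanoword_kei \<alpha> \<tau> \<beta> w').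
    \<phi> (kei_input \<alpha> \<tau> \<beta> w) = kei_input \<alpha> \<tau> \<beta> w' \<and>
    \<phi> (kei_output \<alpha> \<tau> \<beta> w) = kei_output \<alpha> \<tau> \<beta> w'"
proof -
  let ?step = "\<lambda>M M'. is_nanoword \<alpha> M \<and> is_nanoword \<alpha> M' \<and>
    (nanoword_isomorphic M M' \<or> homotopy_move \<alpha> \<tau> M M')"
  have same: "isomorphic_triples \<alpha> \<tau> \<beta> M M'" if "?step M M'" for M M' :: "('l, 'a) nanoword"
    using that isomorphic_triples_isomorphic[OF assms(1)]
      isomorphic_triples_move[OF assms(1,3)] by blast
  have "equivclp ?step w w'" using assms(6) by (simp add: homotopic_def)
  then have "isomorphic_triples \<alpha> \<tau> \<beta> w w'"
  proof (induction rule: equivclp_induct)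
    case base
    show ?case by (rule isomorphic_triples_refl)
  next
    case (step M M')
    have "isomorphic_triples \<alpha> \<tau> \<beta> M M'"
      using step(2) same isomorphic_triples_sym[OF assms(1)] by blast
    with step(3) show ?case by (rule isomorphic_triples_trans)
  qed
  then show ?thesis by (simp only: isomorphic_triples_def)
qed

end
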